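(* Let $\alpha$ be the parameter of a family of very simple increasing trees, and let $L(\mathcal{T}_n)$ be the label of the centroid (the one nearest to the root) in a random tree of size $n$ from this family. As $n\to\infty$, $L(\mathcal{T}_n)$ converges in distribution to a discrete random variable $\mathcal{L}$ taking positive integer values; that is, $\lim_{n\to\infty}P_n(L=k)=P(\mathcal{L}=k)$ for every integer $k\ge1$, where $$P(\mathcal{L}=k)=\begin{cases}1-\frac{\alpha}{\alpha-1}\left(1-2^{-(\alpha-1)}\right)&\text{if }k=1,\\ I_{1/2}(k-1,\alpha)-\frac{\alpha}{\alpha-1}I_{1/2}(k,\alpha-1)&\text{if }k\ge2.\end{cases}$$ Alternatively, for all $k\ge1$, $$P(\mathcal{L}=k)=-\frac{1}{\alpha-1}I_{1/2}(k,\alpha)+\left(1+\frac{\alpha}{\alpha-1}\right)\binom{\alpha+k-2}{k-1}2^{-(\alpha+k-1)}.$$ (For $\alpha=1$ the expressions on the right are to be read as their limits as $\alpha\to1$.)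
   Context: Notation: $I_x(a,b)=\frac{1}{B(a,b)}\int_0^xt^{a-1}(1-t)^{b-1}\,dt$ for $0\le x<1$ is the regularised incomplete beta function, with $B(a,b)=\Gamma(a)\Gamma(b)/\Gamma(a+b)$ (this is also used for $-1<b<0$). For real $x$ and an integer $r\ge0$, $\binom{x}{r}=x(x-1)\cdots(x-r+1)/r!$. Random trees. An increasing tree of size $n$ is a rooted tree with $n$ nodes labelled $1,\dots,n$ such that labels increase along every path leading away from the root (so the root has label $1$). A family of very simple increasing trees is given by real constants $c_1>0$ and $c_2$; put $\alpha=1+c_2/c_1>0$. The admissible cases are: $c_2=0$, $\alpha=1$ (general recursive trees); $c_2<0$, $0<\alpha<1$ (general plane-oriented trees); $c_2>0$, $\alpha=d/(d-1)$ with an integer $d\ge2$ (general $d$-ary increasing trees). A plane (i.e. ordered) increasing tree $T$ has weight $\omega(T)=\prod_v\phi_{\mathrm{outdeg}(v)}$, where $\sum_i\phi_iu^i=\phi(u)$ with $\phi(u)=\exp(c_1u)$ if $c_2=0$ and $\phi(u)=(1+c_2u)^{1+c_1/c_2}$ otherwise; a random tree $\mathcal{T}_n$ of size $n$ is drawn with probability proportional to its weight. Equivalently (ignoring the order of children), the random tree is produced by the growth process which starts with the root $1$ and, for $i=2,\dots,n$, attaches node $i$ as a child to an existing node of current out-degree $k$ with probability $\frac{\alpha-(\alpha-1)k}{i+\alpha-2}$. $P_n$ denotes probability for a random tree of size $n$. Centroid. A centroid of a tree is a node minimising the sum of distances to all other nodes; equivalently, each branch at the node (maximal subtree not containing it)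 contains at most half of the nodes of the tree. Every tree has one centroid or two adjacent centroids; "the centroid" means the one nearest to the root. $L=L(T)$ is the label of the centroid. *)

theory Defs
  imports "HOL-Probability.Probability"
    "HOL-Computational_Algebra.Formal_Power_Series"
begin

(* Plane (ordered) rooted trees; the nodes are identified with their labels. *)
datatype plane_tree = Node (root_label: nat) (children: "plane_tree list")

primrec labels :: "plane_tree \<Rightarrow> nat list" where
  "labels (Node x ts) = x # concat (map labels ts)"

fun label_increasing :: "plane_tree \<Rightarrow> bool" where
  "label_increasing (Node x ts) \<longleftrightarrow> (\<forall>t\<in>set ts. x < root_label t \<and> label_increasing t)"

definition increasing_trees :: "nat \<Rightarrow> plane_tree set" where
  "increasing_trees n =
     {T. distinct (labels T) \<and> set (labels T) = {1..n} \<and> label_increasing T}"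

definition alpha :: "real \<Rightarrow> real \<Rightarrow> real" where
  "alpha c1 c2 = 1 + c2 / c1"

definition very_simple_family :: "real \<Rightarrow> real \<Rightarrow> bool" where
  "very_simple_family c1 c2 \<longleftrightarrow> c1 > 0 \<and>
     (c2 = 0
      \<or> (c2 < 0 \<and> 0 < alpha c1 c2 \<and> alpha c1 c2 < 1)
      \<or> (c2 > 0 \<and> (\<exists>d::nat. d \<ge> 2 \<and> alpha c1 c2 = real d / (real d - 1))))"

(* The power series exp (c1 u), respectively (1 + c2 u) to the power 1 + c1/c2:
   fps_binomial a is the binomial series of (1 + u) to the power a. *)
definition degree_series :: "real \<Rightarrow> real \<Rightarrow> real fps" where
  "degree_series c1 c2 =
     (if c2 = 0 then fps_exp c1
      else fps_compose (fps_binomial (1 + c1 / c2)) (fps_const c2 * fps_X))"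

primrec tree_weight :: "real \<Rightarrow> real \<Rightarrow> plane_tree \<Rightarrow> real" where
  "tree_weight c1 c2 (Node x ts) =
     fps_nth (degree_series c1 c2) (length ts) * prod_list (map (tree_weight c1 c2) ts)"

(* Only meaningful for n \<ge> 1: there is no tree of size 0. *)
definition random_tree :: "real \<Rightarrow> real \<Rightarrow> nat \<Rightarrow> plane_tree pmf" where
  "random_tree c1 c2 n = embed_pmf (\<lambda>T.
     if T \<in> increasing_trees n
     then tree_weight c1 c2 T / (\<Sum>S\<in>increasing_trees n. tree_weight c1 c2 S)
     else 0)"

primrec tree_edges :: "plane_tree \<Rightarrow> (nat \<times> nat) set" where
  "tree_edges (Node x ts) =
     (\<lambda>t. (x, root_label t)) ` set ts \<union> \<Union> (set (map tree_edges ts))"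

definition tree_dist :: "plane_tree \<Rightarrow> nat \<Rightarrow> nat \<Rightarrow> nat" where
  "tree_dist T v w = (LEAST m. (v, w) \<in> (tree_edges T \<union> (tree_edges T)\<inverse>) ^^ m)"

definition total_dist :: "plane_tree \<Rightarrow> nat \<Rightarrow> nat" where
  "total_dist T v = (\<Sum>w\<in>set (labels T). tree_dist T v w)"

definition is_centroid :: "plane_tree \<Rightarrow> nat \<Rightarrow> bool" where
  "is_centroid T v \<longleftrightarrow>
     v \<in> set (labels T) \<and> (\<forall>w\<in>set (labels T). total_dist T v \<le> total_dist T w)"

definition centroid_label :: "plane_tree \<Rightarrow> nat" where
  "centroid_label T = (ARG_MIN (tree_dist T (root_label T)) v. is_centroid T v)"

(* Beta is defined through Gamma, so negative non-integer b is covered. *)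
definition reg_inc_beta :: "real \<Rightarrow> real \<Rightarrow> real \<Rightarrow> real" where
  "reg_inc_beta x a b =
     1 / Beta a b * integral {0..x} (\<lambda>t. t powr (a - 1) * (1 - t) powr (b - 1))"

(* The two expressions below are junk at a = 1 (division by zero); there one
   has to take the limit a \<rightarrow> 1 instead of evaluating them. *)
definition centroid_prob :: "real \<Rightarrow> nat \<Rightarrow> real" where
  "centroid_prob a k =
     (if k = 1 then 1 - a / (a - 1) * (1 - 2 powr (- (a - 1)))
      else reg_inc_beta (1/2) (real k - 1) a
           - a / (a - 1) * reg_inc_beta (1/2) (real k) (a - 1))"

definition centroid_prob_alt :: "real \<Rightarrow> nat \<Rightarrow> real" where
  "centroid_prob_alt a k =
     - (1 / (a - 1)) * reg_inc_beta (1/2) (real k) a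
     + (1 + a / (a - 1)) * ((a + real k - 2) gchoose (k - 1)) * 2 powr (- (a + real k - 1))"

end

theory Submission
  imports Defs
begin

text \<open>The first idea is that the centroid nearest to the root is an extremal label. Moving from a node to
one of its children \<open>c\<close> changes the sum of distances by \<open>n - 2 S(c)\<close>, where \<open>S(c)\<close> is the size of
the subtree below \<open>c\<close>, so it pays to move down exactly as long as the child is \<^emph>\<open>heavy\<close>, that is,
\<open>2 S(c) > n\<close>. Two disjoint subtrees cannot both be heavy, so the heavy nodes form a chain that starts
at the root, and the centroid is its last node. Hence \<open>L = k\<close> holds if and only if \<open>k\<close> is heavy and no
child of \<open>k\<close> is heavy (\<open>centroid_label_iff\<close>), and since at most one child of \<open>k\<close> is heavy,
\<open>P(L = k)\<close> is the probability that \<open>k\<close> is heavy minus the expected number of heavy children of \<open>k\<close>.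

The second idea is that a plane increasing tree of size \<open>n + 1\<close> arises in exactly one way by inserting
the leaf \<open>n + 1\<close> into a gap between the children of a node of a tree of size \<open>n\<close>
(\<open>bij_betw_insert_leaf\<close>). The recurrence of the coefficients \<open>\<phi>\<^sub>i\<close> turns the total weight of the gaps
at a node of out-degree \<open>k\<close> into \<open>c\<^sub>1 (\<alpha> - (\<alpha> - 1) k)\<close>, which gives the growth process
(\<open>weighted_sum_growth\<close>). A subtree with \<open>s\<close> nodes then attracts the next node with weight proportional
to \<open>s + \<alpha> - 1\<close> and the rest of the tree with weight proportional to \<open>n - s\<close>: this is a Polya urn. Its
weights are products of factorials (\<open>subtree_weight_growth\<close>), and so are the expected numbers of children of
\<open>k\<close> with a given subtree size (\<open>child_weight_growth\<close>). Written with beta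
functions, they yield the exact formula \<open>centroid_prob_finite\<close> for every finite \<open>n\<close>.

Writing each beta function as an integral, the sum over the heavy sizes \<open>s > n/2\<close> becomes an integral
against the probability that a binomial variable exceeds half of its range. By the law of large
numbers this probability tends to an indicator function, and dominated convergence leaves an incomplete
beta integral (\<open>upper_beta_sum_tendsto\<close>). The limits sum to 1 because the
negative binomial series evaluates the total masses of the two parts (\<open>limit_prob_sums\<close>), so no mass
escapes and they are the point probabilities of a distribution. The closed forms of the theorem
follow from integration by parts. The form used throughout, \<open>limit_prob\<close>, has no singularity at \<open>\<alpha> = 1\<close> and is continuous in \<open>\<alpha>\<close>, which settles
the case \<open>\<alpha> = 1\<close>.\<close>

section \<open>Plane trees and their ordered lists of children\<close>

text \<open>The edges as a list: it keeps the order of the children, and its second components are a permutation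
of the labels below the root. This makes uniqueness of parents a consequence of distinct labels.\<close>
fun edge_list :: "plane_tree \<Rightarrow> (nat \<times> nat) list" where
  "edge_list (Node x ts) = map (\<lambda>t. (x, root_label t)) ts @ concat (map edge_list ts)"

text \<open>A plane tree with distinct labels is determined by its root and this function, so statements about
inserting a leaf reduce to statements about lists of labels.\<close>
definition child_labels :: "plane_tree \<Rightarrow> nat \<Rightarrow> nat list" where
  "child_labels T v = map snd (filter (\<lambda>e. fst e = v) (edge_list T))"

text \<open>Here \<open>i\<close> is the number of children of \<open>v\<close> that stay to the left of the new leaf \<open>m\<close>.\<close>
fun insert_leaf :: "nat \<Rightarrow> nat \<Rightarrow> nat \<Rightarrow> plane_tree \<Rightarrow> plane_tree" where
  "insert_leaf m v i (Node x ts) =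
     Node x (if x = v then take i ts @ Node m [] # drop i ts else map (insert_leaf m v i) ts)"

lemma root_in_labels: "root_label T \<in> set (labels T)"
  by (cases T) simp

lemma set_edge_list: "set (edge_list T) = tree_edges T"
  by (induction T) auto

lemma fst_edge_list: "e \<in> set (edge_list T) \<Longrightarrow> fst e \<in> set (labels T)"
  by (induction T) auto

lemma mset_labels_edge_list:
  "mset (labels T) = add_mset (root_label T) (mset (map snd (edge_list T)))"
proof (induction T)
  case (Node x ts)
  have "mset (concat (map labels ts)) = 
      mset (map root_label ts) + mset (concat (map (map snd \<circ> edge_list) ts))"
    using Node by (induction ts) auto
  then show ?case
    by (simp add: map_concat o_def)
qed

lemma child_labels_absent: "v \<notin> set (labels T) \<Longrightarrow> child_labels T v = []"
  unfolding child_labels_def using fst_edge_list by (force simp: filter_empty_conv)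

lemma child_labels_root:
  assumes "x \<notin> set (concat (map labels ts))"
  shows "child_labels (Node x ts) x = map root_label ts"
proof -
  have "filter (\<lambda>e. fst e = x) (concat (map edge_list ts)) = []"
    using assms fst_edge_list by (fastforce simp: filter_empty_conv)
  then show ?thesis by (simp add: child_labels_def o_def)
qed

lemma child_labels_Node:
  "child_labels (Node x ts) v =
     (if v = x then map root_label ts else []) @ concat (map (\<lambda>t. child_labels t v) ts)"
  by (simp add: child_labels_def filter_concat map_concat o_def)

lemma child_labels_leaf: "child_labels (Node m []) v = []"
  by (simp add: child_labels_def)

lemma child_labels_middle:
  assumes "v \<noteq> x" "\<And>t. t \<in> set as \<union> set bs \<Longrightarrow> v \<notin> set (labels t)"
  shows "child_labels (Node x (as @ t # bs)) v = child_labels t v"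
proof -
  have "concat (map (\<lambda>t. child_labels t v) as) = []" "concat (map (\<lambda>t. child_labels t v) bs) = []"
    using assms child_labels_absent by auto
  then show ?thesis
    unfolding child_labels_Node map_append list.map concat_append concat.simps
    using assms(1) by (simp del: concat_eq_Nil_conv)
qed

lemma distinct_labels_split:
  assumes "distinct (labels (Node x ts))" "t \<in> set ts"
  obtains as bs where "ts = as @ t # bs" "x \<notin> set (labels t)" "distinct (labels t)"
    "\<And>v s. v \<in> set (labels t) \<Longrightarrow> s \<in> set as \<union> set bs \<Longrightarrow> v \<notin> set (labels s)"
proof -
  obtain as bs where ts: "ts = as @ t # bs" using assms(2) by (meson split_list)
  show ?thesis
    using assms(1) unfolding ts by (intro that[OF ts]) auto
qed

lemma child_labels_subtree:
  assumes "distinct (labels (Node x ts))" "t \<in> set ts" "v \<in> set (labels t)"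
  shows "child_labels (Node x ts) v = child_labels t v"
proof -
  obtain as bs where *: "ts = as @ t # bs" "x \<notin> set (labels t)" "distinct (labels t)"
    "\<And>v s. v \<in> set (labels t) \<Longrightarrow> s \<in> set as \<union> set bs \<Longrightarrow> v \<notin> set (labels s)"
    using distinct_labels_split[OF assms(1,2)] by metis
  show ?thesis using child_labels_middle * assms(3) by metis
qed

text \<open>The weight depends on the out-degrees alone; in this form the effect of one additional leaf is a
change of a single factor.\<close>
lemma tree_weight_prod_list:
  assumes "distinct (labels T)"
  shows "tree_weight c1 c2 T =
    prod_list (map (\<lambda>v. fps_nth (degree_series c1 c2) (length (child_labels T v))) (labels T))"
  using assms
proof (induction T)
  case (Node x ts)
  let ?f = "fps_nth (degree_series c1 c2)"
  have eq: "tree_weight c1 c2 t =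
      prod_list (map (\<lambda>v. ?f (length (child_labels (Node x ts) v))) (labels t))" if "t \<in> set ts" for t
  proof -
    have "distinct (labels t)" using Node.prems that by (meson distinct_labels_split)
    then have "tree_weight c1 c2 t = prod_list (map (\<lambda>v. ?f (length (child_labels t v))) (labels t))"
      using Node.IH that by blast
    also have "map (\<lambda>v. ?f (length (child_labels t v))) (labels t)
        = map (\<lambda>v. ?f (length (child_labels (Node x ts) v))) (labels t)"
      by (rule map_cong) (use child_labels_subtree[OF Node.prems that] in auto)
    finally show ?thesis .
  qed
  have flat: "prod_list (map g (concat (map labels ts))) = 
      prod_list (map (\<lambda>t. prod_list (map g (labels t))) ts)" for g :: "nat \<Rightarrow> real" and ts
    by (induction ts) auto
  have "prod_list (map (tree_weight c1 c2) ts) = prod_list (map (\<lambda>t. prod_list 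
      (map (\<lambda>v. ?f (length (child_labels (Node x ts) v))) (labels t))) ts)"
    by (rule arg_cong[where f=prod_list], rule map_cong) (use eq in auto)
  also have "\<dots> = prod_list (map (\<lambda>v. ?f (length (child_labels (Node x ts) v))) (concat (map labels ts)))"
    by (simp add: flat)
  finally show ?case using Node.prems child_labels_root by simp
qed

text \<open>A plane tree can be rebuilt from its root by reading off the children of each node from \<open>ch\<close>.
Unlike equality of the functions \<open>child_labels\<close>, this condition passes to subtrees.\<close>
fun follows :: "(nat \<Rightarrow> nat list) \<Rightarrow> plane_tree \<Rightarrow> bool" where
  "follows ch (Node x ts) \<longleftrightarrow> map root_label ts = ch x \<and> (\<forall>t\<in>set ts. follows ch t)"

lemma follows_unique:
  "follows ch T \<Longrightarrow> follows ch T' \<Longrightarrow> root_label T = root_label T' \<Longrightarrow> T = T'"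
proof (induction T arbitrary: T')
  case (Node x ts)
  obtain ts' where T': "T' = Node x ts'" using Node.prems by (cases T') auto
  have m: "map root_label ts = map root_label ts'" using Node.prems T' by simp
  have "ts = ts'"
  proof (rule nth_equalityI)
    show len: "length ts = length ts'" using m by (metis length_map)
    fix i assume i: "i < length ts"
    have "root_label (ts ! i) = root_label (ts' ! i)" using m i len by (metis nth_map)
    moreover have "ts ! i \<in> set ts" "ts' ! i \<in> set ts'" using i len by auto
    ultimately show "ts ! i = ts' ! i" using Node.IH Node.prems T' by auto
  qed
  then show ?case using T' by simp
qed

lemma follows_cong:
  "(\<And>v. v \<in> set (labels T) \<Longrightarrow> ch v = ch' v) \<Longrightarrow> follows ch T \<longleftrightarrow> follows ch' T"
  by (induction T) auto

lemma follows_child_labels: "distinct (labels T) \<Longrightarrow> follows (child_labels T) T"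
proof (induction T)
  case (Node x ts)
  have "follows (child_labels (Node x ts)) t" if "t \<in> set ts" for t
  proof -
    have "distinct (labels t)" using Node.prems that by (meson distinct_labels_split)
    then have "follows (child_labels t) t" using Node.IH that by blast
    then show ?thesis using follows_cong child_labels_subtree[OF Node.prems that] by metis
  qed
  then show ?case using Node.prems child_labels_root by simp
qed

lemma child_labels_determine_tree:
  assumes "distinct (labels T)" "distinct (labels T')" "root_label T = root_label T'"
    "child_labels T = child_labels T'"
  shows "T = T'"
  using follows_unique follows_child_labels assms by metis

lemma root_insert_leaf [simp]: "root_label (insert_leaf m v i T) = root_label T"
  by (cases T) simp

lemma insert_leaf_absent: "v \<notin> set (labels T) \<Longrightarrow> insert_leaf m v i T = T"
  by (induction T) (auto intro!: map_idI)

lemma insert_leaf_middle: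
  assumes "v \<noteq> x" "\<And>t. t \<in> set as \<union> set bs \<Longrightarrow> v \<notin> set (labels t)"
  shows "insert_leaf m v i (Node x (as @ t # bs)) = Node x (as @ insert_leaf m v i t # bs)"
proof -
  have "map (insert_leaf m v i) as = as" "map (insert_leaf m v i) bs = bs"
    using assms(2) insert_leaf_absent by (auto intro!: map_idI)
  then show ?thesis using assms(1) by simp
qed

lemma mset_concat_insert: 
  "mset (concat (map f (take i ts @ t # drop i ts))) = mset (f t) + mset (concat (map f ts))"
proof -
  have "mset (concat (map f (take i ts))) + mset (concat (map f (drop i ts))) = mset (concat (map f ts))"
    by (metis append_take_drop_id concat_append map_append mset_append)
  then show ?thesis by simp
qed

text \<open>Distinctness of the labels makes \<open>v\<close> occur in one subtree only, so that the recursion of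
\<open>insert_leaf\<close> changes one place of the tree.\<close>
lemma insert_leaf_labels_children:
  assumes "distinct (labels T)" "v \<in> set (labels T)" "m \<notin> set (labels T)"
  shows "mset (labels (insert_leaf m v i T)) = add_mset m (mset (labels T)) \<and>
    child_labels (insert_leaf m v i T) = (child_labels T)
      (v := take i (child_labels T v) @ m # drop i (child_labels T v))"
  using assms
proof (induction T)
  case (Node x ts)
  show ?case
  proof (cases "x = v")
    case True
    let ?ts = "take i ts @ Node m [] # drop i ts"
    have x: "x \<notin> set (concat (map labels ts))" using Node.prems by auto
    then have x': "x \<notin> set (concat (map labels ?ts))"
      using Node.prems by (auto dest: in_set_takeD in_set_dropD)
    have "child_labels (Node x ?ts) u = child_labels (Node x ts) u" if "u \<noteq> x" for u
    proof -
      have "child_labels (Node x ?ts) u = 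
          concat (map (\<lambda>t. child_labels t u) (take i ts @ drop i ts))"
        using that unfolding child_labels_Node map_append concat_append 
        by (simp add: child_labels_leaf)
      then show ?thesis by (simp add: child_labels_Node that)
    qed
    moreover have "child_labels (Node x ?ts) x = 
        take i (child_labels (Node x ts) x) @ m # drop i (child_labels (Node x ts) x)"
      by (simp only: child_labels_root[OF x] child_labels_root[OF x'])
        (simp add: take_map drop_map)
    ultimately have "child_labels (Node x ?ts) = (child_labels (Node x ts))
      (v := take i (child_labels (Node x ts) v) @ m # drop i (child_labels (Node x ts) v))"
      using True by (simp add: fun_eq_iff)
    moreover have "mset (labels (Node x ?ts)) = add_mset m (mset (labels (Node x ts)))"
      by (simp only: labels.simps mset.simps mset_concat_insert) simp
    ultimately show ?thesis using True by simp
  next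
    case False
    then obtain t where t: "t \<in> set ts" "v \<in> set (labels t)" using Node.prems by auto
    obtain as bs where *: "ts = as @ t # bs" "x \<notin> set (labels t)" "distinct (labels t)"
      "\<And>v s. v \<in> set (labels t) \<Longrightarrow> s \<in> set as \<union> set bs \<Longrightarrow> v \<notin> set (labels s)"
      using distinct_labels_split[OF Node.prems(1) t(1)] by metis
    let ?t = "insert_leaf m v i t"
    have mt: "m \<notin> set (labels t)" using Node.prems t by auto
    note IH = Node.IH[OF t(1) *(3) t(2) mt]
    have ins: "insert_leaf m v i (Node x ts) = Node x (as @ ?t # bs)"
      unfolding *(1) using insert_leaf_middle[of v x as bs] False *(4) t(2) by metis
    have "mset (labels (Node x (as @ ?t # bs))) = add_mset m (mset (labels (Node x ts)))"
      using IH *(1) by simp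
    moreover have "child_labels (Node x (as @ ?t # bs)) u = child_labels (Node x ts) u" if "u \<noteq> v" for u
    proof -
      have "child_labels ?t u = child_labels t u" using IH that by simp
      then show ?thesis unfolding *(1) child_labels_Node by simp
    qed
    moreover have "child_labels (Node x (as @ ?t # bs)) v = 
        take i (child_labels (Node x ts) v) @ m # drop i (child_labels (Node x ts) v)"
    proof -
      have d: "v \<notin> set (labels s)" if "s \<in> set as \<union> set bs" for s using *(4) t(2) that by blast
      show ?thesis unfolding *(1) using child_labels_middle[OF False[symmetric] d] IH by simp
    qed
    ultimately show ?thesis unfolding ins by (simp add: fun_eq_iff)
  qed
qed

lemma label_increasing_insert_leaf:
  "v < m \<Longrightarrow> label_increasing (insert_leaf m v i T) \<longleftrightarrow> label_increasing T"
proof (induction T)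
  case (Node x ts)
  have "set ts = set (take i ts) \<union> set (drop i ts)" by (metis append_take_drop_id set_append)
  then show ?case using Node by auto
qed

text \<open>Removing a leaf is the inverse of inserting it; the tree \<open>T\<close> is obtained by deleting \<open>m\<close> from the
list of children that contains it.\<close>
lemma leaf_is_inserted:
  assumes "distinct (labels T')" "m \<in> set (labels T')" "m \<noteq> root_label T'" "child_labels T' m = []"
  shows "\<exists>T v i. T' = insert_leaf m v i T \<and> v \<in> set (labels T) \<and> i \<le> length (child_labels T v) \<and>
    mset (labels T') = add_mset m (mset (labels T))"
  using assms
proof (induction T')
  case (Node x ts)
  then obtain t where t: "t \<in> set ts" "m \<in> set (labels t)" by auto
  obtain as bs where *: "ts = as @ t # bs" "x \<notin> set (labels t)" "distinct (labels t)"
    "\<And>v s. v \<in> set (labels t) \<Longrightarrow> s \<in> set as \<union> set bs \<Longrightarrow> v \<notin> set (labels s)"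
    using distinct_labels_split[OF Node.prems(1) t(1)] by metis
  have leaf: "child_labels t m = []" using Node.prems child_labels_subtree t by metis
  show ?case
  proof (cases "root_label t = m")
    case True
    then have tm: "t = Node m []"
      using leaf *(3) by (cases t) (use child_labels_root in auto)
    have x: "x \<notin> set (concat (map labels (as @ bs)))" using Node.prems *(1) by auto
    have "Node x ts = insert_leaf m x (length as) (Node x (as @ bs))"
      using *(1) tm by simp
    moreover have "mset (labels (Node x ts)) = add_mset m (mset (labels (Node x (as @ bs))))"
      using *(1) tm by simp
    ultimately show ?thesis using child_labels_root[OF x] 
      by (intro exI[of _ "Node x (as @ bs)"] exI[of _ x] exI[of _ "length as"]) simp
  next
    case False
    obtain t0 v i where t0: "t = insert_leaf m v i t0" "v \<in> set (labels t0)" 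
        "i \<le> length (child_labels t0 v)" "mset (labels t) = add_mset m (mset (labels t0))"
      using Node.IH[OF t(1) *(3) t(2)] False leaf by metis
    have vt: "v \<in> set (labels t)" using t0(2,4) by (metis insert_iff set_mset_add_mset_insert set_mset_mset)
    then have vx: "v \<noteq> x" using * by metis
    have d: "v \<notin> set (labels s)" if "s \<in> set as \<union> set bs" for s using * vt that by blast
    have "Node x ts = insert_leaf m v i (Node x (as @ t0 # bs))"
      using insert_leaf_middle[OF vx d] *(1) t0(1) by simp
    moreover have "mset (labels (Node x ts)) = add_mset m (mset (labels (Node x (as @ t0 # bs))))"
      using *(1) t0(4) by simp
    moreover have "i \<le> length (child_labels (Node x (as @ t0 # bs)) v)"
      using child_labels_middle[OF vx d] t0(3) by simp
    ultimately show ?thesis using t0(2) 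
      by (intro exI[of _ "Node x (as @ t0 # bs)"] exI[of _ v] exI[of _ i]) simp
  qed
qed

lemma edges_label_increasing: "label_increasing T \<Longrightarrow> (u, v) \<in> tree_edges T \<Longrightarrow> u < v"
  by (induction T) auto

lemma child_labels_edges: "c \<in> set (child_labels T v) \<longleftrightarrow> (v, c) \<in> tree_edges T"
  unfolding child_labels_def set_edge_list[symmetric] by force

lemma distinct_edge_list:
  assumes "distinct (labels T)"
  shows "distinct (map snd (edge_list T))" "root_label T \<notin> snd ` tree_edges T"
    "set (labels T) = insert (root_label T) (snd ` tree_edges T)"
proof -
  have m: "mset (labels T) = mset (root_label T # map snd (edge_list T))"
    using mset_labels_edge_list by simp
  have "distinct (root_label T # map snd (edge_list T))"
    using assms mset_eq_imp_distinct_iff[OF m] by blast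
  then show "distinct (map snd (edge_list T))" "root_label T \<notin> snd ` tree_edges T"
    by (auto simp: set_edge_list)
  show "set (labels T) = insert (root_label T) (snd ` tree_edges T)"
    using mset_eq_setD[OF m] by (simp add: set_edge_list)
qed

lemma distinct_child_labels:
  assumes "distinct (labels T)"
  shows "distinct (child_labels T v)"
  unfolding child_labels_def using distinct_edge_list(1)[OF assms]
  by (simp add: distinct_map_filter)

lemma set_child_labels: "set (child_labels T v) = tree_edges T `` {v}"
  using child_labels_edges by auto

lemma length_child_labels:
  "distinct (labels T) \<Longrightarrow> length (child_labels T v) = card (tree_edges T `` {v})"
  using distinct_child_labels set_child_labels distinct_card by metis

section \<open>Increasing trees grow by inserting the largest label\<close>

text \<open>The labelled, unordered increasing trees, as sets of edges from parents to children. Subtree sizes,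
distances and out-degrees depend on the edges only, so the probabilistic part can forget the plane order.\<close>
definition recursive_tree :: "nat \<Rightarrow> (nat \<times> nat) set \<Rightarrow> bool" where
  "recursive_tree n E \<longleftrightarrow> E \<subseteq> {1..n} \<times> {1..n} \<and> (\<forall>(u, v)\<in>E. u < v) \<and> (\<forall>v\<in>{2..n}. \<exists>!u. (u, v) \<in> E)"

lemma label_increasing_root_le: "label_increasing T \<Longrightarrow> v \<in> set (labels T) \<Longrightarrow> root_label T \<le> v"
proof (induction T)
  case (Node x ts)
  show ?case
  proof (cases "v = x")
    case False
    then obtain t where "t \<in> set ts" "v \<in> set (labels t)" using Node.prems by auto
    then show ?thesis using Node.IH[of t] Node.prems by force
  qed simp
qed

lemma root_increasing_trees:
  assumes "n \<ge> 1" "T \<in> increasing_trees n"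
  shows "root_label T = 1"
proof -
  have "root_label T \<le> 1" using assms label_increasing_root_le[of T 1] by (auto simp: increasing_trees_def)
  moreover have "root_label T \<ge> 1" using assms root_in_labels[of T] by (auto simp: increasing_trees_def)
  ultimately show ?thesis by simp
qed

lemma recursive_tree_edges:
  assumes "n \<ge> 1" "T \<in> increasing_trees n"
  shows "recursive_tree n (tree_edges T)"
proof -
  have T: "distinct (labels T)" "set (labels T) = {1..n}" "label_increasing T" "root_label T = 1"
    using assms root_increasing_trees by (auto simp: increasing_trees_def)
  note d = distinct_edge_list[OF T(1)]
  have "snd e \<in> {1..n}" "fst e \<in> {1..n}" if "e \<in> tree_edges T" for e
    using that T(2) d(3) fst_edge_list[of e T] set_edge_list by auto
  then have "tree_edges T \<subseteq> {1..n} \<times> {1..n}" by force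
  moreover have "\<exists>!u. (u, v) \<in> tree_edges T" if "v \<in> {2..n}" for v
  proof -
    have "v \<in> set (labels T)" "v \<noteq> root_label T" using T that by simp_all
    then have "v \<in> snd ` tree_edges T" using d(3) by blast
    then obtain u where u: "(u, v) \<in> tree_edges T" by force
    moreover have "u' = u" if "(u', v) \<in> tree_edges T" for u'
    proof -
      have "inj_on snd (set (edge_list T))" using d(1) distinct_map by blast
      then show ?thesis using u that unfolding set_edge_list inj_on_def by force
    qed
    ultimately show ?thesis by blast
  qed
  ultimately show ?thesis
    unfolding recursive_tree_def using edges_label_increasing[OF T(3)] by auto
qed

definition leaf_insertions :: "nat \<Rightarrow> (plane_tree \<times> nat \<times> nat) set" where
  "leaf_insertions n =
     (SIGMA T:increasing_trees n. SIGMA v:{1..n}. {0..length (child_labels T v)})"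

text \<open>The largest label is a leaf, so deleting it inverts the insertion. The insertion is injective because
the lists of children of the new tree show the parent of the new leaf, its position, and, after
removal of the new label, all lists of children of the old tree.\<close>
lemma bij_betw_insert_leaf:
  assumes n: "n \<ge> 1"
  shows "bij_betw (\<lambda>(T, v, i). insert_leaf (Suc n) v i T) (leaf_insertions n) (increasing_trees (Suc n))"
  unfolding bij_betw_def
proof (intro conjI set_eqI iffI)
  let ?f = "\<lambda>(T, v, i). insert_leaf (Suc n) v i T"
  show "inj_on ?f (leaf_insertions n)"
  proof (rule inj_onI, clarsimp simp: leaf_insertions_def)
    fix T v i T' v' i'
    assume T: "T \<in> increasing_trees n" and v: "Suc 0 \<le> v" "v \<le> n" and i: "i \<le> length (child_labels T v)"
      and T': "T' \<in> increasing_trees n" and v': "Suc 0 \<le> v'" "v' \<le> n" and i': "i' \<le> length (child_labels T' v')"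
      and eq: "insert_leaf (Suc n) v i T = insert_leaf (Suc n) v' i' T'"
    let ?c = "child_labels T" let ?c' = "child_labels T'"
    have d: "distinct (labels T)" "distinct (labels T')" using T T' by (auto simp: increasing_trees_def)
    have "?c (v := take i (?c v) @ Suc n # drop i (?c v)) = child_labels (insert_leaf (Suc n) v i T)"
      using insert_leaf_labels_children[of T v "Suc n" i] T v by (auto simp: increasing_trees_def)
    also have "\<dots> = ?c' (v' := take i' (?c' v') @ Suc n # drop i' (?c' v'))"
      using insert_leaf_labels_children[of T' v' "Suc n" i'] T' v' eq by (auto simp: increasing_trees_def)
    finally have ceq: "?c (v := take i (?c v) @ Suc n # drop i (?c v)) =
       ?c' (v' := take i' (?c' v') @ Suc n # drop i' (?c' v'))" .
    have no: "Suc n \<notin> set (?c u)" "Suc n \<notin> set (?c' u)" for u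
      using recursive_tree_edges[OF n T] recursive_tree_edges[OF n T']
      unfolding child_labels_edges recursive_tree_def by auto
    have vv: "v = v'"
    proof (rule ccontr)
      assume "v \<noteq> v'"
      then have "take i (?c v) @ Suc n # drop i (?c v) = ?c' v" using fun_cong[OF ceq, of v] by simp
      then show False using no(2)[of v] by (metis in_set_conv_decomp)
    qed
    then have "take i (?c v) @ Suc n # drop i (?c v) = take i' (?c' v) @ Suc n # drop i' (?c' v)"
      using fun_cong[OF ceq, of v] by simp
    then have td: "take i (?c v) = take i' (?c' v)" "drop i (?c v) = drop i' (?c' v)"
      using no[of v] append_Cons_eq_iff[of "Suc n" "take i (?c v)" "drop i (?c v)" "take i' (?c' v)" "drop i' (?c' v)"]
      by (meson in_set_takeD in_set_dropD)+
    then have cv: "?c v = ?c' v" by (metis append_take_drop_id)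
    have "i = i'" using td(1) i i' vv by (metis length_take min.absorb2)
    moreover have "?c u = ?c' u" for u
      using fun_cong[OF ceq, of u] cv vv by (cases "u = v") auto
    then have "T = T'"
      using child_labels_determine_tree[OF d] T T' root_increasing_trees[OF n] by presburger
    ultimately show "T = T' \<and> v = v' \<and> i = i'" using vv by simp
  qed
  fix T' assume "T' \<in> ?f ` leaf_insertions n"
  then obtain T v i where T: "T \<in> increasing_trees n" and v: "v \<in> {1..n}"
      and T': "T' = insert_leaf (Suc n) v i T"
    by (auto simp: leaf_insertions_def)
  have m: "mset (labels T') = mset (Suc n # labels T)"
    using insert_leaf_labels_children[of T v "Suc n" i] T v T' by (auto simp: increasing_trees_def)
  have "distinct (labels T')" using mset_eq_imp_distinct_iff[OF m] T by (auto simp: increasing_trees_def)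
  moreover have "set (labels T') = {1..Suc n}" 
    using mset_eq_setD[OF m] T by (auto simp: increasing_trees_def)
  moreover have "label_increasing T'" 
    using label_increasing_insert_leaf[of v "Suc n" i T] T v T' by (auto simp: increasing_trees_def)
  ultimately show "T' \<in> increasing_trees (Suc n)" by (auto simp: increasing_trees_def)
next
  let ?f = "\<lambda>(T, v, i). insert_leaf (Suc n) v i T"
  fix T' assume T': "T' \<in> increasing_trees (Suc n)"
  then have d: "distinct (labels T')" "set (labels T') = {1..Suc n}" "label_increasing T'"
    by (auto simp: increasing_trees_def)
  have rt: "root_label T' = 1" using root_increasing_trees[of "Suc n" T'] T' by simp
  have "child_labels T' (Suc n) = []"
  proof -
    have "set (child_labels T' (Suc n)) = {}"
      using recursive_tree_edges[of "Suc n" T'] T' unfolding set_child_labels recursive_tree_def by fastforce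
    then show ?thesis by simp
  qed
  then obtain T v i where T: "T' = insert_leaf (Suc n) v i T" "v \<in> set (labels T)" 
      "i \<le> length (child_labels T v)" "mset (labels T') = add_mset (Suc n) (mset (labels T))"
    using leaf_is_inserted[OF d(1), of "Suc n"] d(2) rt n by auto
  have m: "mset (labels T') = mset (Suc n # labels T)" using T(4) by simp
  have "distinct (Suc n # labels T)" using mset_eq_imp_distinct_iff[OF m] d(1) by blast
  then have dT: "distinct (labels T)" "Suc n \<notin> set (labels T)" by auto
  have "{1..Suc n} = insert (Suc n) (set (labels T))" using mset_eq_setD[OF m] d(2) by simp
  then have sT: "set (labels T) = {1..n}" using dT(2) n
    by (metis Diff_insert_absorb atLeastAtMost_iff atLeastAtMostSuc_conv le_SucI not_less_eq_eq order_refl)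
  have v: "v \<in> {1..n}" using T(2) sT by simp
  then have "label_increasing T" using d(3) T(1) label_increasing_insert_leaf[of v "Suc n" i T] by simp
  then have "(T, v, i) \<in> leaf_insertions n"
    using dT sT v T(3) by (auto simp: leaf_insertions_def increasing_trees_def)
  then show "T' \<in> ?f ` leaf_insertions n" using T(1) by force
qed

lemma increasing_trees_1: "increasing_trees 1 = {Node 1 []}"
proof -
  have "T = Node 1 []" if "T \<in> increasing_trees 1" for T
  proof -
    obtain x ts where T: "T = Node x ts" by (cases T)
    have "ts = []"
    proof (rule ccontr)
      assume "ts \<noteq> []"
      then obtain t where t: "t \<in> set ts" by (cases ts) auto
      have "root_label t \<in> {1}" "x \<in> {1}" "x \<notin> set (labels t)"
        using that t root_in_labels[of t] unfolding T increasing_trees_def by auto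
      then show False using root_in_labels[of t] by auto
    qed
    then show ?thesis using that T by (auto simp: increasing_trees_def)
  qed
  then show ?thesis by (auto simp: increasing_trees_def)
qed

lemma finite_increasing_trees: "n \<ge> 1 \<Longrightarrow> finite (increasing_trees n)"
proof (induction n rule: dec_induct)
  case base
  then show ?case by (simp only: increasing_trees_1) simp
next
  case (step n)
  then have "finite (leaf_insertions n)" by (auto simp: leaf_insertions_def intro!: finite_SigmaI)
  then show ?case using bij_betw_insert_leaf step(1) bij_betw_finite by blast
qed

lemma degree_series_0 [simp]: "fps_nth (degree_series c1 c2) 0 = 1"
  by (simp add: degree_series_def fps_compose_linear)

text \<open>Differentiating gives \<open>\<phi>'(u) (1 + c\<^sub>2 u) = (c\<^sub>1 + c\<^sub>2) \<phi>(u)\<close> for the binomial series and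
\<open>\<phi>' = c\<^sub>1 \<phi>\<close> for the exponential series; the recurrence below is the coefficient form of both.
The factor \<open>k + 1\<close> on the left is the number of gaps between \<open>k\<close> children, where a new child fits.
The identity is stated without division since the coefficients of d-ary trees vanish eventually.\<close>
lemma degree_series_Suc:
  assumes "c1 > 0"
  shows "real (Suc k) * fps_nth (degree_series c1 c2) (Suc k) =
    c1 * (alpha c1 c2 - (alpha c1 c2 - 1) * real k) * fps_nth (degree_series c1 c2) k"
proof (cases "c2 = 0")
  case True
  then show ?thesis by (simp add: degree_series_def alpha_def fact_Suc del: of_nat_Suc fact_Suc)
    (simp only: fact_Suc of_nat_mult, simp del: of_nat_Suc)
next
  case False
  have "real (Suc k) * ((1 + c1 / c2) gchoose Suc k) = (1 + c1 / c2 - real k) * ((1 + c1 / c2) gchoose k)"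
    using gbinomial_absorption'[of "Suc k" "1 + c1/c2"] gbinomial_mult_1[of "1 + c1/c2" k]
    by (simp add: field_simps)
  moreover have "c1 * (alpha c1 c2 - (alpha c1 c2 - 1) * real k) = c2 * (1 + c1 / c2 - real k)"
    using assms False by (simp add: alpha_def field_simps)
  ultimately show ?thesis using False
    by (simp add: degree_series_def fps_compose_linear del: of_nat_Suc)
qed

lemma tree_weight_prod:
  assumes "n \<ge> 1" "T \<in> increasing_trees n"
  shows "tree_weight c1 c2 T =
    (\<Prod>v\<in>{1..n}. fps_nth (degree_series c1 c2) (length (child_labels T v)))"
  using assms tree_weight_prod_list[of T c1 c2] 
  by (simp add: increasing_trees_def prod.distinct_set_conv_list[symmetric])

text \<open>The growth process: a node of out-degree \<open>k\<close> attracts the new label with weight proportional to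
\<open>\<alpha> - (\<alpha> - 1) k\<close>. All \<open>k + 1\<close> plane insertions at this node produce the same edges and the same weight.\<close>
lemma weighted_sum_growth:
  assumes n: "n \<ge> 1" and c1: "c1 > 0"
  shows "(\<Sum>T\<in>increasing_trees (Suc n). tree_weight c1 c2 T * g (tree_edges T)) =
    (\<Sum>T\<in>increasing_trees n. tree_weight c1 c2 T * (\<Sum>v\<in>{1..n}.
       c1 * (alpha c1 c2 - (alpha c1 c2 - 1) * real (card (tree_edges T `` {v})))
         * g (insert (v, Suc n) (tree_edges T))))"
proof -
  let ?w = "tree_weight c1 c2" let ?\<phi> = "fps_nth (degree_series c1 c2)"
  let ?wt = "\<lambda>T v. c1 * (alpha c1 c2 - (alpha c1 c2 - 1) * real (card (tree_edges T `` {v})))"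
  let ?F = "\<lambda>T. ?w T * g (tree_edges T)"
  have fin: "finite (increasing_trees n)" using n by (rule finite_increasing_trees)
  have "sum ?F (increasing_trees (Suc n)) = 
      (\<Sum>(T, v, i)\<in>leaf_insertions n. ?F (insert_leaf (Suc n) v i T))"
    using sum.reindex_bij_betw[OF bij_betw_insert_leaf[OF n], of ?F] by (simp add: case_prod_unfold)
  also have "\<dots> = (\<Sum>T\<in>increasing_trees n. \<Sum>v\<in>{1..n}. \<Sum>i\<in>{0..length (child_labels T v)}.
      ?F (insert_leaf (Suc n) v i T))"
    unfolding leaf_insertions_def using fin by (simp add: sum.Sigma[symmetric])
  also have "\<dots> = (\<Sum>T\<in>increasing_trees n. \<Sum>v\<in>{1..n}. 
      ?w T * (?wt T v * g (insert (v, Suc n) (tree_edges T))))"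
  proof (intro sum.cong refl)
    fix T v assume T: "T \<in> increasing_trees n" and v: "v \<in> {1..n}"
    then have T': "distinct (labels T)" "v \<in> set (labels T)" "Suc n \<notin> set (labels T)"
      by (auto simp: increasing_trees_def)
    let ?d = "length (child_labels T v)"
    let ?R = "\<Prod>u\<in>{1..n}-{v}. ?\<phi> (length (child_labels T u))"
    have d: "?d = card (tree_edges T `` {v})" using length_child_labels T' by blast
    have "?F (insert_leaf (Suc n) v i T) = ?\<phi> (Suc ?d) * ?R * g (insert (v, Suc n) (tree_edges T))"
      if "i \<in> {0..?d}" for i
    proof -
      let ?T = "insert_leaf (Suc n) v i T"
      have cl: "child_labels ?T = (child_labels T)
          (v := take i (child_labels T v) @ Suc n # drop i (child_labels T v))"
        using insert_leaf_labels_children[OF T'] by blast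
      have IT: "?T \<in> increasing_trees (Suc n)"
        using bij_betw_apply[OF bij_betw_insert_leaf[OF n], of "(T, v, i)"] T v that
        by (auto simp: leaf_insertions_def)
      have "?w ?T = (\<Prod>u\<in>{1..n}. ?\<phi> (length (child_labels ?T u))) * ?\<phi> (length (child_labels ?T (Suc n)))"
        using tree_weight_prod[OF _ IT] by simp
      also have "child_labels ?T (Suc n) = []"
        using cl v child_labels_absent[OF T'(3)] by simp
      also have "(\<Prod>u\<in>{1..n}. ?\<phi> (length (child_labels ?T u))) = 
          ?\<phi> (length (child_labels ?T v)) * (\<Prod>u\<in>{1..n}-{v}. ?\<phi> (length (child_labels ?T u)))"
        using v by (simp add: prod.remove)
      also have "(\<Prod>u\<in>{1..n}-{v}. ?\<phi> (length (child_labels ?T u))) = ?R"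
        by (rule prod.cong) (auto simp: cl)
      also have "length (child_labels ?T v) = Suc ?d" using that by (simp add: cl)
      finally have "?w ?T = ?\<phi> (Suc ?d) * ?R" by simp
      moreover have "(u, c) \<in> tree_edges ?T \<longleftrightarrow> (u, c) \<in> insert (v, Suc n) (tree_edges T)" for u c
      proof -
        have "set (take i (child_labels T v)) \<union> set (drop i (child_labels T v)) = set (child_labels T v)"
          by (metis append_take_drop_id set_append)
        then show ?thesis unfolding child_labels_edges[symmetric] insert_iff prod.inject cl by auto
      qed
      then have "tree_edges ?T = insert (v, Suc n) (tree_edges T)" by auto
      ultimately show ?thesis by simp
    qed
    then have "(\<Sum>i\<in>{0..?d}. ?F (insert_leaf (Suc n) v i T)) = 
       (real (Suc ?d) * ?\<phi> (Suc ?d)) * ?R * g (insert (v, Suc n) (tree_edges T))"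
      by simp
    also have "\<dots> = ?wt T v * (?\<phi> ?d * ?R) * g (insert (v, Suc n) (tree_edges T))"
      using degree_series_Suc[OF c1] d by simp
    also have "?\<phi> ?d * ?R = ?w T" using tree_weight_prod[OF n T] v by (simp add: prod.remove)
    finally show "(\<Sum>i\<in>{0..?d}. ?F (insert_leaf (Suc n) v i T)) = 
       ?w T * (?wt T v * g (insert (v, Suc n) (tree_edges T)))" by simp
  qed
  finally show ?thesis by (simp add: sum_distrib_left)
qed

text \<open>For \<open>\<alpha> \<le> 1\<close> all factors in the recurrence of the coefficients are positive. For d-ary trees the factor
is a positive multiple of \<open>d - k\<close>, so the coefficients are nonnegative up to \<open>d\<close> and zero afterwards.\<close>
lemma tree_weight_nonneg:
  assumes "very_simple_family c1 c2"
  shows "tree_weight c1 c2 T \<ge> 0"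
proof -
  let ?\<phi> = "fps_nth (degree_series c1 c2)" let ?a = "alpha c1 c2"
  have c1: "c1 > 0" using assms by (simp add: very_simple_family_def)
  have \<phi>: "?\<phi> k \<ge> 0" for k
  proof (cases "?a \<le> 1")
    case True
    have a: "?a > 0" using assms True by (auto simp: very_simple_family_def alpha_def add_pos_pos divide_pos_pos)
    show ?thesis
    proof (induction k)
      case (Suc k)
      have "?a - (?a - 1) * real k \<ge> 0" 
        using a True mult_nonneg_nonneg[of "1 - ?a" "real k"] by (simp add: algebra_simps)
      then have "real (Suc k) * ?\<phi> (Suc k) \<ge> 0"
        unfolding degree_series_Suc[OF c1] using Suc c1 by simp
      then show ?case by (simp add: zero_le_mult_iff)
    qed simp
  next
    case False
    then obtain d :: nat where d: "d \<ge> 2" "?a = real d / (real d - 1)"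
      using assms by (auto simp: very_simple_family_def alpha_def)
    have f: "?a - (?a - 1) * real k = (real d - real k) / (real d - 1)" for k
      using d by (simp add: field_simps)
    have "?\<phi> k \<ge> 0 \<and> (k > d \<longrightarrow> ?\<phi> k = 0)"
    proof (induction k)
      case (Suc k)
      have e: "real (Suc k) * ?\<phi> (Suc k) = c1 * ((real d - real k) / (real d - 1)) * ?\<phi> k"
        using degree_series_Suc[OF c1, of k c2] unfolding f .
      consider "k < d" | "k = d" | "k > d" by linarith
      then show ?case
      proof cases
        case 1
        then have "real (Suc k) * ?\<phi> (Suc k) \<ge> 0" unfolding e using Suc c1 d by simp
        then show ?thesis using 1 by (simp add: zero_le_mult_iff)
      qed (use e Suc in simp_all)
    qed simp
    then show ?thesis by blast
  qed
  show ?thesis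
  proof (induction T)
    case (Node x ts)
    have "prod_list (map (tree_weight c1 c2) ts) \<ge> 0"
      by (rule prod_list_nonneg) (use Node in auto)
    then show ?case using \<phi> by simp
  qed
qed

section \<open>Descendants and distances in a recursive tree\<close>

definition subtree_size :: "(nat \<times> nat) set \<Rightarrow> nat \<Rightarrow> nat" where
  "subtree_size E v = card (E\<^sup>* `` {v})"

lemma recursive_tree_parent_unique:
  assumes "recursive_tree n E" "(u, w) \<in> E" "(v, w) \<in> E"
  shows "u = v"
proof -
  have "w \<in> {2..n}" using assms(1,2) unfolding recursive_tree_def by fastforce
  then show ?thesis using assms unfolding recursive_tree_def by blast
qed

lemma recursive_tree_less: "recursive_tree n E \<Longrightarrow> (u, v) \<in> E \<Longrightarrow> u < v"
  by (auto simp: recursive_tree_def)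

lemma recursive_tree_rtrancl_le:
  assumes "recursive_tree n E" "(u, v) \<in> E\<^sup>*"
  shows "u \<le> v"
  using assms(2) by (induction rule: rtrancl_induct) (use recursive_tree_less[OF assms(1)] in force)+

lemma recursive_tree_descendants_subset:
  assumes "recursive_tree n E" "v \<in> {1..n}"
  shows "E\<^sup>* `` {v} \<subseteq> {1..n}"
proof
  fix w assume "w \<in> E\<^sup>* `` {v}"
  then have "(v, w) \<in> E\<^sup>*" by simp
  then show "w \<in> {1..n}" 
    by cases (use assms in \<open>auto simp: recursive_tree_def\<close>)
qed

lemma recursive_tree_root_ancestor:
  assumes "recursive_tree n E" "v \<in> {1..n}"
  shows "(1, v) \<in> E\<^sup>*"
  using assms(2)
proof (induction v rule: less_induct)
  case (less v)
  show ?case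
  proof (cases "v = 1")
    case False
    then have "v \<in> {2..n}" using less.prems by simp
    then obtain u where u: "(u, v) \<in> E" using assms(1) unfolding recursive_tree_def by blast
    moreover have "u < v" "u \<in> {1..n}" using assms(1) u unfolding recursive_tree_def by auto
    ultimately show ?thesis using less.IH[of u] by (meson rtrancl.rtrancl_into_rtrancl)
  qed simp
qed

text \<open>Parents are unique, so the ancestors of a node form a chain, which the labels order from the root down.\<close>
lemma recursive_tree_ancestors_comparable:
  assumes "recursive_tree n E" "(u, w) \<in> E\<^sup>*" "(v, w) \<in> E\<^sup>*" "u \<le> v"
  shows "(u, v) \<in> E\<^sup>*"
proof -
  have "single_valued (E\<inverse>)"
    using recursive_tree_parent_unique[OF assms(1)] by (auto simp: single_valued_def)
  then have "(u, v) \<in> (E\<inverse>)\<^sup>* \<or> (v, u) \<in> (E\<inverse>)\<^sup>*"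
    using assms(2,3) single_valued_confluent[of "E\<inverse>" w u v] by (simp add: rtrancl_converse)
  then have "(u, v) \<in> E\<^sup>* \<or> (v, u) \<in> E\<^sup>*" by (auto simp: rtrancl_converse)
  moreover have "u = v" if "(v, u) \<in> E\<^sup>*"
    using recursive_tree_rtrancl_le[OF assms(1) that] assms(4) by simp
  ultimately show ?thesis by auto
qed

lemma subtree_size_mono:
  assumes "recursive_tree n E" "u \<in> {1..n}" "(u, v) \<in> E\<^sup>*"
  shows "subtree_size E v \<le> subtree_size E u"
  unfolding subtree_size_def
proof (rule card_mono)
  show "finite (E\<^sup>* `` {u})"
    using recursive_tree_descendants_subset[OF assms(1,2)] finite_subset by blast
  show "E\<^sup>* `` {v} \<subseteq> E\<^sup>* `` {u}" using assms(3) by (auto intro: rtrancl_trans)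
qed

lemma subtree_size_root:
  assumes "recursive_tree n E" "n \<ge> 1"
  shows "subtree_size E 1 = n"
proof -
  have "E\<^sup>* `` {1} = {1..n}"
    using recursive_tree_descendants_subset[OF assms(1), of 1] assms(2)
      recursive_tree_root_ancestor[OF assms(1)] by auto
  then show ?thesis by (simp add: subtree_size_def)
qed

lemma sym_relpow:
  assumes "sym R" "(v, w) \<in> R ^^ m"
  shows "(w, v) \<in> R ^^ m"
  using assms(2)
proof (induction m arbitrary: w)
  case (Suc m)
  then obtain z where "(v, z) \<in> R ^^ m" "(z, w) \<in> R" by (meson relpow_Suc_E)
  then have "(z, v) \<in> R ^^ m" "(w, z) \<in> R" using Suc.IH symD[OF assms(1)] by simp_all
  then show ?case by (metis relpow_Suc_I2)
qed simp

text \<open>If a walk can leave \<open>A\<close> only by stepping to \<open>b\<close>, then every walk from \<open>a\<close> to a point outside passes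
through \<open>b\<close>, so that the distance from \<open>a\<close> exceeds that from \<open>b\<close> by exactly one.\<close>
lemma least_relpow_bridge:
  fixes R :: "('a \<times> 'a) set"
  assumes ab: "(a, b) \<in> R" "a \<in> A" "b \<notin> A" "w \<notin> A"
    and cross: "\<And>x y. (x, y) \<in> R \<Longrightarrow> x \<in> A \<Longrightarrow> y \<notin> A \<Longrightarrow> y = b"
    and reach: "(b, w) \<in> R\<^sup>*"
  shows "(LEAST m. (a, w) \<in> R ^^ m) = Suc (LEAST m. (b, w) \<in> R ^^ m)"
proof (rule Least_equality)
  let ?l = "LEAST m. (b, w) \<in> R ^^ m"
  obtain m where "(b, w) \<in> R ^^ m" using reach rtrancl_imp_relpow by blast
  then have "(b, w) \<in> R ^^ ?l" by (rule LeastI)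
  then show "(a, w) \<in> R ^^ Suc ?l" using ab(1) by (metis relpow_Suc_I2)
  \<comment> \<open>The first step out of \<open>A\<close> costs at least one step, and what remains is a walk from \<open>b\<close>.\<close>
  have first: "\<exists>m'<m. (b, w) \<in> R ^^ m'" if "(x, w) \<in> R ^^ m" "x \<in> A" for x m
    using that
  proof (induction m arbitrary: x)
    case 0
    then show ?case using ab(4) by simp
  next
    case (Suc m)
    then obtain z where z: "(x, z) \<in> R" "(z, w) \<in> R ^^ m" by (meson relpow_Suc_E2)
    show ?case
    proof (cases "z \<in> A")
      case True
      then show ?thesis using Suc.IH[OF z(2)] less_SucI by metis
    next
      case False
      then have "z = b" using cross z(1) Suc.prems by blast
      then show ?thesis using z(2) by blast
    qed
  qed
  show "Suc ?l \<le> m" if aw: "(a, w) \<in> R ^^ m" for m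
  proof -
    obtain m' where m': "m' < m" "(b, w) \<in> R ^^ m'"
      using first[OF aw ab(2)] by blast
    have "?l \<le> m'" using m'(2) by (rule Least_le)
    then show ?thesis using m'(1) by simp
  qed
qed

definition edge_dist :: "(nat \<times> nat) set \<Rightarrow> nat \<Rightarrow> nat \<Rightarrow> nat" where
  "edge_dist E v w = (LEAST m. (v, w) \<in> (E \<union> E\<inverse>) ^^ m)"

lemma edge_dist_commute: "edge_dist E v w = edge_dist E w v"
proof -
  have "sym (E \<union> E\<inverse>)" by (auto simp: sym_def)
  then have "(v, w) \<in> (E \<union> E\<inverse>) ^^ m \<longleftrightarrow> (w, v) \<in> (E \<union> E\<inverse>) ^^ m" for m
    by (intro iffI) (rule sym_relpow, assumption+)+
  then show ?thesis by (simp add: edge_dist_def)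
qed

lemma recursive_tree_connected:
  assumes "recursive_tree n E" "v \<in> {1..n}" "w \<in> {1..n}"
  shows "(v, w) \<in> (E \<union> E\<inverse>)\<^sup>*"
proof -
  have sub: "E\<^sup>* \<subseteq> (E \<union> E\<inverse>)\<^sup>*" by (rule rtrancl_mono) simp
  have "sym ((E \<union> E\<inverse>)\<^sup>*)" by (rule sym_rtrancl) (auto simp: sym_def)
  moreover have "(1, v) \<in> (E \<union> E\<inverse>)\<^sup>*" "(1, w) \<in> (E \<union> E\<inverse>)\<^sup>*"
    using recursive_tree_root_ancestor[OF assms(1)] assms(2,3) sub by auto
  ultimately show ?thesis by (meson rtrancl_trans symD)
qed

text \<open>The edge from \<open>v\<close> to \<open>c\<close> is a bridge between the descendants of \<open>c\<close> and all other nodes.\<close>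
lemma edge_dist_child:
  assumes E: "recursive_tree n E" and e: "(v, c) \<in> E" and w: "w \<in> {1..n}"
  shows "(c, w) \<notin> E\<^sup>* \<Longrightarrow> edge_dist E c w = Suc (edge_dist E v w)"
    and "(c, w) \<in> E\<^sup>* \<Longrightarrow> edge_dist E v w = Suc (edge_dist E c w)"
proof -
  define C where "C = E\<^sup>* `` {c}"
  have C: "(c, x) \<in> E\<^sup>* \<longleftrightarrow> x \<in> C" for x by (simp add: C_def)
  have cC: "c \<in> C" by (simp add: C_def)
  have vc: "v \<in> {1..n}" "c \<in> {1..n}" "v < c"
    using E e recursive_tree_less[OF E e] by (auto simp: recursive_tree_def)
  then have v: "v \<notin> C" using recursive_tree_rtrancl_le[OF E, of c v] C by force
  have down: "b \<in> C" if "(a, b) \<in> E" "a \<in> C" for a b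
    using that C by (meson rtrancl_into_rtrancl)
  have up: "a \<in> C" if ab: "(a, b) \<in> E" "b \<in> C" "b \<noteq> c" for a b
  proof -
    have "(c, b) \<in> E\<^sup>*" using ab C by simp
    then obtain z where "(c, z) \<in> E\<^sup>*" "(z, b) \<in> E" using ab(3) by (auto elim: rtranclE)
    then show ?thesis using recursive_tree_parent_unique[OF E ab(1)] C by blast
  qed
  note conn = recursive_tree_connected[OF E _ w]
  show "edge_dist E c w = Suc (edge_dist E v w)" if "(c, w) \<notin> E\<^sup>*"
    unfolding edge_dist_def
  proof (rule least_relpow_bridge[where A = C])
    show "y = v" if "(x, y) \<in> E \<union> E\<inverse>" "x \<in> C" "y \<notin> C" for x y
    proof -
      have "(y, x) \<in> E" using that down[of x y] by blast
      then have "x = c" using up[of y x] that by blast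
      then show ?thesis using recursive_tree_parent_unique[OF E e] \<open>(y, x) \<in> E\<close> by simp
    qed
    show "(c, v) \<in> E \<union> E\<inverse>" using e by simp
    show "w \<notin> C" using that C by blast
  qed (fact cC v conn[OF vc(1)])+
  show "edge_dist E v w = Suc (edge_dist E c w)" if "(c, w) \<in> E\<^sup>*"
    unfolding edge_dist_def
  proof (rule least_relpow_bridge[where A = "- C"])
    show "y = c" if "(x, y) \<in> E \<union> E\<inverse>" "x \<in> - C" "y \<notin> - C" for x y
    proof -
      have "(x, y) \<in> E" using that down[of y x] by blast
      then show ?thesis using up[of x y] that by blast
    qed
    show "(v, c) \<in> E \<union> E\<inverse>" using e by simp
    show "v \<in> - C" using v by simp
    show "c \<notin> - C" using cC by simp
    show "w \<notin> - C" using that C by simp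
  qed (fact conn[OF vc(2)])
qed

text \<open>Moving from \<open>v\<close> to its child \<open>c\<close>, the descendants of \<open>c\<close> come closer by one and all other nodes
recede by one. Both sides are written with additions because they are natural numbers.\<close>
lemma total_dist_child:
  assumes E: "recursive_tree n E" and e: "(v, c) \<in> E"
  shows "(\<Sum>w\<in>{1..n}. edge_dist E c w) + 2 * subtree_size E c = (\<Sum>w\<in>{1..n}. edge_dist E v w) + n"
proof -
  let ?C = "E\<^sup>* `` {c}"
  have c: "c \<in> {1..n}" using E e by (auto simp: recursive_tree_def)
  then have C: "?C \<subseteq> {1..n}" by (rule recursive_tree_descendants_subset[OF E])
  have split: "(\<Sum>w\<in>{1..n}. f w) = (\<Sum>w\<in>{1..n}-?C. f w) + (\<Sum>w\<in>?C. f w)" for f :: "nat \<Rightarrow> nat"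
    by (rule sum.subset_diff[OF C]) simp
  have "(\<Sum>w\<in>{1..n}-?C. edge_dist E c w) = (\<Sum>w\<in>{1..n}-?C. edge_dist E v w + 1)"
    using edge_dist_child(1)[OF E e] by (intro sum.cong) auto
  moreover have "(\<Sum>w\<in>?C. edge_dist E v w) = (\<Sum>w\<in>?C. edge_dist E c w + 1)"
    using edge_dist_child(2)[OF E e] C by (intro sum.cong) auto
  moreover have "card ({1..n} - ?C) + card ?C = n"
    using card_Diff_subset[of ?C "{1..n}"] C card_mono[OF _ C] finite_subset[OF C] by simp
  ultimately show ?thesis unfolding split sum.distrib subtree_size_def by simp
qed

section \<open>The centroid is the last heavy node\<close>

text \<open>The heavy nodes are the ancestors of the heavy node with the largest label (including itself), and the
sum of distances decreases strictly along this chain. From a heavy node to a light child, or from light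
to light, it does not decrease, and the distance from the root grows. Thus the last heavy
node \<open>z\<close> minimises the sum of distances, and among all minimisers it is the strictly nearest to the root.\<close>
theorem centroid_label_iff:
  assumes n: "n \<ge> 1" and T: "T \<in> increasing_trees n"
  defines "E \<equiv> tree_edges T"
  shows "centroid_label T = k \<longleftrightarrow>
    k \<in> {1..n} \<and> n < 2 * subtree_size E k \<and> (\<forall>c\<in>E `` {k}. 2 * subtree_size E c \<le> n)"
proof -
  have E: "recursive_tree n E" unfolding E_def by (rule recursive_tree_edges[OF n T])
  have lab: "set (labels T) = {1..n}" using T by (simp add: increasing_trees_def)
  have dist: "tree_dist T = edge_dist E" by (simp add: fun_eq_iff tree_dist_def edge_dist_def E_def)
  define D where "D = (\<lambda>v. \<Sum>w\<in>{1..n}. edge_dist E v w)"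
  have cen: "is_centroid T v \<longleftrightarrow> v \<in> {1..n} \<and> (\<forall>w\<in>{1..n}. D v \<le> D w)" for v
    by (simp add: is_centroid_def total_dist_def D_def lab dist)
  have D: "D c + 2 * subtree_size E c = D v + n" if "(v, c) \<in> E" for v c
    unfolding D_def by (rule total_dist_child[OF E that])
  define H where "H = {v\<in>{1..n}. n < 2 * subtree_size E v}"
  have H1: "1 \<in> H" using n subtree_size_root[OF E n] by (simp add: H_def)
  define z where "z = Max H"
  have finH: "finite H" by (simp add: H_def)
  have zH: "z \<in> H" unfolding z_def using finH H1 by (intro Max_in) auto
  have Hz: "h \<le> z" if "h \<in> H" for h unfolding z_def using finH that by simp
  \<comment> \<open>Two sets that contain more than half of the nodes intersect.\<close>
  have anc: "(h, z) \<in> E\<^sup>*" if h: "h \<in> H" for h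
  proof -
    have sub: "E\<^sup>* `` {h} \<subseteq> {1..n}" "E\<^sup>* `` {z} \<subseteq> {1..n}"
      using recursive_tree_descendants_subset[OF E] h zH by (auto simp: H_def)
    have "E\<^sup>* `` {h} \<inter> E\<^sup>* `` {z} \<noteq> {}"
    proof
      assume dis: "E\<^sup>* `` {h} \<inter> E\<^sup>* `` {z} = {}"
      have "card (E\<^sup>* `` {h} \<union> E\<^sup>* `` {z}) \<le> card {1..n}"
        using sub by (intro card_mono) auto
      then have "subtree_size E h + subtree_size E z \<le> n"
        using card_Un_disjoint[OF finite_subset[OF sub(1)] finite_subset[OF sub(2)] dis]
        by (simp add: subtree_size_def)
      then show False using h zH by (simp add: H_def)
    qed
    then obtain w where "(h, w) \<in> E\<^sup>*" "(z, w) \<in> E\<^sup>*" by auto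
    then show ?thesis using recursive_tree_ancestors_comparable[OF E] Hz[OF h] by blast
  qed
  have heavy: "h = z \<or> D z < D h" if "(h, z) \<in> E\<^sup>*" for h
    using that
  proof (induction rule: converse_rtrancl_induct)
    case (step y x)
    have "x \<in> {1..n}" using step(1) E by (auto simp: recursive_tree_def)
    then have "n < 2 * subtree_size E x"
      using subtree_size_mono[OF E _ step(2)] zH by (auto simp: H_def)
    then show ?case using D[OF step(1)] step(3) by auto
  qed simp
  \<comment> \<open>Equality is possible: a subtree of size exactly \<open>n/2\<close> gives a second centroid below \<open>z\<close>.\<close>
  have light: "D z \<le> D w \<and> (D w = D z \<longrightarrow> edge_dist E 1 z < edge_dist E 1 w)"
    if "w \<in> {1..n}" "w \<notin> H" for w
    using that
  proof (induction w rule: less_induct)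
    case (less w)
    then have "w \<in> {2..n}" using H1 by (cases "w = 1") auto
    then obtain u where u: "(u, w) \<in> E" using E unfolding recursive_tree_def by blast
    have u': "u < w" "u \<in> {1..n}" using u E by (auto simp: recursive_tree_def)
    have "(w, 1) \<notin> E\<^sup>*" using recursive_tree_rtrancl_le[OF E, of w 1] u' by auto
    then have "edge_dist E 1 w = Suc (edge_dist E 1 u)"
      using edge_dist_child(1)[OF E u, of 1] n edge_dist_commute by simp
    moreover have "D u \<le> D w" using D[OF u] less.prems by (simp add: H_def)
    moreover have "D z \<le> D u \<and> (D u = D z \<longrightarrow> edge_dist E 1 z \<le> edge_dist E 1 u)"
    proof (cases "u \<in> H")
      case True
      then show ?thesis using heavy[OF anc[OF True]] by auto
    next
      case False
      then show ?thesis using less.IH[OF u'] by auto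
    qed
    ultimately show ?case by auto
  qed
  have zn: "z \<in> {1..n}" using zH by (simp add: H_def)
  have "D z \<le> D w" if "w \<in> {1..n}" for w
    using light[OF that] heavy[OF anc, of w] by (cases "w \<in> H") auto
  then have zc: "is_centroid T z" using zn by (simp add: cen)
  have nearest: "edge_dist E 1 z < edge_dist E 1 w" if w: "is_centroid T w" "w \<noteq> z" for w
  proof -
    have "D w = D z" using w(1) zc by (auto simp: cen intro!: antisym)
    moreover from this have "w \<notin> H" using heavy[OF anc, of w] w(2) by auto
    ultimately show ?thesis using light[of w] w(1) by (auto simp: cen)
  qed
  have "is_arg_min (edge_dist E 1) (is_centroid T) w \<longleftrightarrow> w = z" for w
  proof (cases "w = z")
    case True
    then show ?thesis unfolding is_arg_min_def using zc nearest by (metis less_asym)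
  next
    case False
    then show ?thesis unfolding is_arg_min_def using zc nearest by blast
  qed
  then have "centroid_label T = z"
    by (simp add: centroid_label_def root_increasing_trees[OF n T] dist arg_min_def)
  moreover have "z = k \<longleftrightarrow> k \<in> H \<and> E `` {k} \<inter> H = {}"
  proof
    assume "z = k"
    moreover have "c \<notin> H" if "(z, c) \<in> E" for c
      using recursive_tree_less[OF E that] Hz[of c] by auto
    ultimately show "k \<in> H \<and> E `` {k} \<inter> H = {}" using zH by auto
  next
    assume k: "k \<in> H \<and> E `` {k} \<inter> H = {}"
    show "z = k"
    proof (rule ccontr)
      assume "z \<noteq> k"
      moreover have "(k, z) \<in> E\<^sup>*" using anc k by simp
      ultimately obtain c where c: "(k, c) \<in> E" "(c, z) \<in> E\<^sup>*"
        by (auto elim: converse_rtranclE)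
      have "c \<in> {1..n}" using E c by (auto simp: recursive_tree_def)
      then have "c \<in> H" using subtree_size_mono[OF E _ c(2)] zH by (auto simp: H_def)
      then show False using c k by auto
    qed
  qed
  moreover have "E `` {k} \<inter> H = {} \<longleftrightarrow> (\<forall>c\<in>E `` {k}. 2 * subtree_size E c \<le> n)"
  proof -
    have "E `` {k} \<subseteq> {1..n}" using E by (auto simp: recursive_tree_def)
    then have "c \<in> H \<longleftrightarrow> \<not> 2 * subtree_size E c \<le> n" if "c \<in> E `` {k}" for c
      using that unfolding H_def by (simp only: mem_Collect_eq not_le) blast
    then show ?thesis unfolding disjoint_iff by blast
  qed
  moreover have "k \<in> H \<longleftrightarrow> k \<in> {1..n} \<and> n < 2 * subtree_size E k" by (simp add: H_def)
  ultimately show ?thesis by blast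
qed

section \<open>The growth process as a Polya urn\<close>

text \<open>Unnormalised expectations; dividing by the value at the constant function 1 gives the expectation
of \<open>g\<close> in a random tree of size \<open>n\<close>.\<close>
definition weighted_sum :: "real \<Rightarrow> real \<Rightarrow> nat \<Rightarrow> ((nat \<times> nat) set \<Rightarrow> real) \<Rightarrow> real" where
  "weighted_sum c1 c2 n g = (\<Sum>T\<in>increasing_trees n. tree_weight c1 c2 T * g (tree_edges T))"

definition attach_weight :: "real \<Rightarrow> (nat \<times> nat) set \<Rightarrow> nat \<Rightarrow> real" where
  "attach_weight a E v = a - (a - 1) * real (card (E `` {v}))"

lemma weighted_sum_cong:
  assumes "n \<ge> 1" "\<And>E. recursive_tree n E \<Longrightarrow> g E = h E"
  shows "weighted_sum c1 c2 n g = weighted_sum c1 c2 n h"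
  unfolding weighted_sum_def using assms recursive_tree_edges by (intro sum.cong) auto

lemma weighted_sum_add:
  "weighted_sum c1 c2 n (\<lambda>E. g E + h E) = weighted_sum c1 c2 n g + weighted_sum c1 c2 n h"
  by (simp add: weighted_sum_def distrib_left sum.distrib)

lemma weighted_sum_diff:
  "weighted_sum c1 c2 n (\<lambda>E. g E - h E) = weighted_sum c1 c2 n g - weighted_sum c1 c2 n h"
  by (simp add: weighted_sum_def right_diff_distrib sum_subtractf)

lemma weighted_sum_cmult:
  "weighted_sum c1 c2 n (\<lambda>E. x * g E) = x * weighted_sum c1 c2 n g"
  by (simp add: weighted_sum_def sum_distrib_left algebra_simps)

lemma weighted_sum_sum:
  "weighted_sum c1 c2 n (\<lambda>E. \<Sum>i\<in>I. g i E) = (\<Sum>i\<in>I. weighted_sum c1 c2 n (g i))"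
  unfolding weighted_sum_def sum_distrib_left by (rule sum.swap)

lemma weighted_sum_Suc:
  assumes "n \<ge> 1" "c1 > 0"
  shows "weighted_sum c1 c2 (Suc n) g = c1 * weighted_sum c1 c2 n
     (\<lambda>E. \<Sum>v\<in>{1..n}. attach_weight (alpha c1 c2) E v * g (insert (v, Suc n) E))"
  unfolding weighted_sum_cmult[symmetric]
  unfolding weighted_sum_def weighted_sum_growth[OF assms] attach_weight_def
  by (simp add: sum_distrib_left mult.assoc)

text \<open>A subtree with \<open>s\<close> nodes has \<open>s - 1\<close> inner edges, so its out-degrees sum to \<open>s - 1\<close> and its nodes attract
with total weight \<open>s \<alpha> - (\<alpha> - 1)(s - 1) = s + \<alpha> - 1\<close>, whatever its shape.\<close>
lemma sum_attach_weight_subtree: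
  assumes E: "recursive_tree n E" and k: "k \<in> {1..n}"
  shows "(\<Sum>v\<in>E\<^sup>* `` {k}. attach_weight a E v) = real (subtree_size E k) + a - 1"
proof -
  let ?D = "E\<^sup>* `` {k}"
  have finD: "finite ?D" using recursive_tree_descendants_subset[OF E k] finite_subset by blast
  have finE: "finite E" using E unfolding recursive_tree_def by (meson finite_SigmaI finite_atLeastAtMost finite_subset)
  have "(\<Sum>v\<in>?D. card (E `` {v})) = card (\<Union>v\<in>?D. E `` {v})"
    using finD finE recursive_tree_parent_unique[OF E]
    by (intro card_UN_disjoint[symmetric]) (auto simp: finite_Image)
  also have "(\<Union>v\<in>?D. E `` {v}) = ?D - {k}"
  proof (intro set_eqI iffI)
    fix c assume "c \<in> (\<Union>v\<in>?D. E `` {v})"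
    then obtain v where v: "(k, v) \<in> E\<^sup>*" "(v, c) \<in> E" by auto
    then have "k < c" using recursive_tree_rtrancl_le[OF E v(1)] recursive_tree_less[OF E v(2)] by simp
    then show "c \<in> ?D - {k}" using v by (auto intro: rtrancl_into_rtrancl)
  next
    fix c assume "c \<in> ?D - {k}"
    then show "c \<in> (\<Union>v\<in>?D. E `` {v})" by (auto elim: rtranclE)
  qed
  finally have "(\<Sum>v\<in>?D. card (E `` {v})) = card ?D - 1" using finD by simp
  moreover have "card ?D \<ge> 1" using finD card_gt_0_iff[of ?D] by force
  ultimately have "(\<Sum>v\<in>?D. real (card (E `` {v}))) = real (card ?D) - 1"
    by (metis of_nat_1 of_nat_diff of_nat_sum)
  moreover have "(\<Sum>v\<in>?D. attach_weight a E v) = real (card ?D) * a - (a - 1) * (\<Sum>v\<in>?D. real (card (E `` {v})))"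
    unfolding attach_weight_def sum_subtractf sum_distrib_left[symmetric] by simp
  ultimately show ?thesis
    unfolding subtree_size_def by (simp only:) (simp add: algebra_simps)
qed

lemma sum_attach_weight:
  assumes "recursive_tree n E" "n \<ge> 1"
  shows "(\<Sum>v\<in>{1..n}. attach_weight a E v) = real n + a - 1"
proof -
  have "E\<^sup>* `` {1} = {1..n}"
    using recursive_tree_descendants_subset[OF assms(1), of 1] assms(2)
      recursive_tree_root_ancestor[OF assms(1)] by auto
  then show ?thesis
    using sum_attach_weight_subtree[OF assms(1), of 1 a] subtree_size_root[OF assms] assms(2) by simp
qed

lemma recursive_tree_fresh:
  assumes "recursive_tree n E"
  shows "(u, Suc n) \<notin> E" "(Suc n, u) \<notin> E"
  using assms by (auto simp: recursive_tree_def)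

lemma finite_recursive_tree_children:
  assumes "recursive_tree n E"
  shows "finite (E `` {k})"
  using assms unfolding recursive_tree_def
  by (meson finite_Image finite_SigmaI finite_atLeastAtMost finite_subset)

lemma subtree_size_insert:
  assumes E: "recursive_tree n E" and k: "k \<in> {1..n}"
  shows "subtree_size (insert (v, Suc n) E) k = subtree_size E k + of_bool (v \<in> E\<^sup>* `` {k})"
proof -
  have D: "E\<^sup>* `` {k} \<subseteq> {1..n}" by (rule recursive_tree_descendants_subset[OF E k])
  have "(Suc n, y) \<in> E\<^sup>* \<longleftrightarrow> y = Suc n" for y
    using recursive_tree_fresh[OF E] by (auto elim: converse_rtranclE)
  then have "(insert (v, Suc n) E)\<^sup>* `` {k} = E\<^sup>* `` {k} \<union> (if v \<in> E\<^sup>* `` {k} then {Suc n} else {})"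
    by (auto simp: rtrancl_insert)
  moreover have "Suc n \<notin> E\<^sup>* `` {k}" "finite (E\<^sup>* `` {k})"
    using D finite_subset by auto
  ultimately show ?thesis by (simp add: subtree_size_def)
qed

lemma subtree_size_new_leaf:
  assumes E: "recursive_tree n E" and v: "v \<in> {1..n}"
  shows "subtree_size (insert (v, Suc n) E) (Suc n) = 1"
proof -
  have "(insert (v, Suc n) E)\<^sup>* `` {Suc n} = {Suc n}"
    using v recursive_tree_fresh[OF E] by (auto elim: converse_rtranclE)
  then show ?thesis by (simp add: subtree_size_def)
qed

lemma subtree_size_pos:
  assumes E: "recursive_tree n E" and k: "k \<in> {1..n}"
  shows "subtree_size E k > 0"
proof -
  have "finite (E\<^sup>* `` {k})" using recursive_tree_descendants_subset[OF E k] finite_subset by blast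
  then show ?thesis unfolding subtree_size_def card_gt_0_iff by auto
qed

text \<open>One urn step: the subtree of \<open>k\<close> grows with weight \<open>s + \<alpha> - 1\<close> at its old size, and keeps its size
with weight \<open>n - s\<close>. In the first term \<open>s\<close> is the size after growth, hence \<open>s + \<alpha> - 2\<close>.\<close>
lemma subtree_size_growth:
  assumes E: "recursive_tree n E" and k: "k \<in> {1..n}"
  shows "(\<Sum>v\<in>{1..n}. attach_weight a E v * of_bool (subtree_size (insert (v, Suc n) E) k = s)) =
    (real s + a - 2) * of_bool (subtree_size E k + 1 = s) + (real n - real s) * of_bool (subtree_size E k = s)"
proof -
  let ?D = "E\<^sup>* `` {k}" and ?S = "subtree_size E k"
  have D: "?D \<subseteq> {1..n}" by (rule recursive_tree_descendants_subset[OF E k])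
  have n: "n \<ge> 1" using k by simp
  let ?f = "\<lambda>v. attach_weight a E v * of_bool (subtree_size (insert (v, Suc n) E) k = s)"
  have "sum ?f {1..n} = sum ?f ({1..n} - ?D) + sum ?f ?D"
    by (rule sum.subset_diff[OF D]) simp
  also have "sum ?f ({1..n} - ?D) = (\<Sum>v\<in>{1..n}-?D. attach_weight a E v) * of_bool (?S = s)"
    unfolding sum_distrib_right using subtree_size_insert[OF E k] by (intro sum.cong) auto
  also have "sum ?f ?D = (\<Sum>v\<in>?D. attach_weight a E v) * of_bool (?S + 1 = s)"
    unfolding sum_distrib_right using subtree_size_insert[OF E k] by (intro sum.cong) auto
  also have "(\<Sum>v\<in>{1..n}-?D. attach_weight a E v) = 
      (\<Sum>v\<in>{1..n}. attach_weight a E v) - (\<Sum>v\<in>?D. attach_weight a E v)"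
    using sum.subset_diff[OF D] by (metis add_diff_cancel_right' finite_atLeastAtMost)
  finally show ?thesis
    unfolding sum_attach_weight[OF E n] sum_attach_weight_subtree[OF E k] by auto
qed

lemma children_subset: "recursive_tree n E \<Longrightarrow> E `` {k} \<subseteq> {1..n}"
  by (auto simp: recursive_tree_def)

text \<open>Each child of \<open>k\<close> follows the same urn, and a further child, of subtree size 1, is created whenever
the new node attaches to \<open>k\<close> itself.\<close>
lemma child_sizes_growth:
  assumes E: "recursive_tree n E" and k: "k \<in> {1..n}"
  shows "(\<Sum>v\<in>{1..n}. attach_weight a E v *
      (\<Sum>c\<in>insert (v, Suc n) E `` {k}. of_bool (subtree_size (insert (v, Suc n) E) c = s))) =
    (real s + a - 2) * (\<Sum>c\<in>E `` {k}. of_bool (subtree_size E c + 1 = s))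
    + (real n - real s) * (\<Sum>c\<in>E `` {k}. of_bool (subtree_size E c = s))
    + of_bool (s = 1) * attach_weight a E k"
proof -
  let ?E = "\<lambda>v. insert (v, Suc n) E"
  have fin: "finite (E `` {k})" by (rule finite_recursive_tree_children[OF E])
  have new: "Suc n \<notin> E `` {k}" using recursive_tree_fresh[OF E] by auto
  have "(\<Sum>c\<in>?E v `` {k}. of_bool (subtree_size (?E v) c = s)) =
      (\<Sum>c\<in>E `` {k}. of_bool (subtree_size (?E v) c = s)) + (of_bool (v = k) * of_bool (s = 1) :: real)"
    if v: "v \<in> {1..n}" for v
  proof (cases "v = k")
    case True
    then have "?E v `` {k} = insert (Suc n) (E `` {k})" by auto
    then show ?thesis using True fin new subtree_size_new_leaf[OF E v] by simp
  next
    case False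
    then have "?E v `` {k} = E `` {k}" by auto
    then show ?thesis using False by simp
  qed
  then have "(\<Sum>v\<in>{1..n}. attach_weight a E v * (\<Sum>c\<in>?E v `` {k}. of_bool (subtree_size (?E v) c = s))) =
     (\<Sum>v\<in>{1..n}. attach_weight a E v * (\<Sum>c\<in>E `` {k}. of_bool (subtree_size (?E v) c = s)))
     + (\<Sum>v\<in>{1..n}. attach_weight a E v * (of_bool (v = k) * of_bool (s = 1)))"
    unfolding sum.distrib[symmetric] by (intro sum.cong) (auto simp: distrib_left)
  also have "(\<Sum>v\<in>{1..n}. attach_weight a E v * (of_bool (v = k) * of_bool (s = 1))) =
      of_bool (s = 1) * attach_weight a E k"
  proof -
    have "(\<Sum>v\<in>{1..n}. attach_weight a E v * (of_bool (v = k) * of_bool (s = 1))) =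
       (\<Sum>v\<in>{1..n}. if v = k then of_bool (s = 1) * attach_weight a E v else 0)"
      by (intro sum.cong) auto
    then show ?thesis using k by simp
  qed
  also have "(\<Sum>v\<in>{1..n}. attach_weight a E v * (\<Sum>c\<in>E `` {k}. of_bool (subtree_size (?E v) c = s))) =
     (\<Sum>c\<in>E `` {k}. \<Sum>v\<in>{1..n}. attach_weight a E v * of_bool (subtree_size (?E v) c = s))"
    unfolding sum_distrib_left by (rule sum.swap)
  also have "\<dots> = (\<Sum>c\<in>E `` {k}. (real s + a - 2) * of_bool (subtree_size E c + 1 = s)
     + (real n - real s) * of_bool (subtree_size E c = s))"
    using children_subset[OF E, of k] by (intro sum.cong refl subtree_size_growth[OF E]) blast
  finally show ?thesis by (simp add: sum.distrib sum_distrib_left)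
qed

text \<open>The attraction of \<open>k\<close> changes, by \<open>1 - \<alpha>\<close>, only if \<open>k\<close> receives the new node; on average this turns the
total weight \<open>n + \<alpha> - 1\<close> into the factor \<open>n\<close>.\<close>
lemma attach_weight_growth:
  assumes E: "recursive_tree n E" and k: "k \<in> {1..n}"
  shows "(\<Sum>v\<in>{1..n}. attach_weight a E v * attach_weight a (insert (v, Suc n) E) k) =
    real n * attach_weight a E k"
proof -
  have n: "n \<ge> 1" using k by simp
  have new: "attach_weight a (insert (v, Suc n) E) k = attach_weight a E k - (a - 1) * of_bool (v = k)" for v
  proof -
    have "insert (v, Suc n) E `` {k} = E `` {k} \<union> (if v = k then {Suc n} else {})" by auto
    moreover have "Suc n \<notin> E `` {k}" using recursive_tree_fresh[OF E] by auto
    ultimately show ?thesis using finite_recursive_tree_children[OF E, of k]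
      by (simp add: attach_weight_def algebra_simps)
  qed
  have "(\<Sum>v\<in>{1..n}. attach_weight a E v * attach_weight a (insert (v, Suc n) E) k) =
     (\<Sum>v\<in>{1..n}. attach_weight a E v * attach_weight a E k 
        - (if v = k then (a - 1) * attach_weight a E v else 0))"
    unfolding new by (intro sum.cong) (auto simp: algebra_simps)
  also have "\<dots> = (\<Sum>v\<in>{1..n}. attach_weight a E v) * attach_weight a E k - (a - 1) * attach_weight a E k"
    using k by (simp add: sum_subtractf sum_distrib_right)
  finally show ?thesis unfolding sum_attach_weight[OF E n] by (simp add: algebra_simps)
qed

lemma total_weight_growth:
  assumes "k \<ge> 1" "c1 > 0"
  shows "weighted_sum c1 c2 (k + N) (\<lambda>_. 1) =
    weighted_sum c1 c2 k (\<lambda>_. 1) * c1 ^ N * pochhammer (alpha c1 c2 + real k - 1) N"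
proof (induction N)
  case (Suc N)
  let ?a = "alpha c1 c2"
  have kN: "k + N \<ge> 1" using assms by simp
  have "weighted_sum c1 c2 (k + Suc N) (\<lambda>_. 1) = 
      c1 * weighted_sum c1 c2 (k + N) (\<lambda>E. \<Sum>v\<in>{1..k+N}. attach_weight ?a E v * 1)"
    using weighted_sum_Suc[OF kN assms(2), of c2 "\<lambda>_. 1"] by simp
  also have "weighted_sum c1 c2 (k + N) (\<lambda>E. \<Sum>v\<in>{1..k+N}. attach_weight ?a E v * 1) = 
      weighted_sum c1 c2 (k + N) (\<lambda>E. (real (k + N) + ?a - 1) * 1)"
    using sum_attach_weight[OF _ kN] by (intro weighted_sum_cong[OF kN]) simp
  finally show ?case using Suc by (simp only: weighted_sum_cmult) (simp add: pochhammer_Suc algebra_simps)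
qed simp

lemma total_weight_1: "weighted_sum c1 c2 1 (\<lambda>_. 1) = 1"
  unfolding weighted_sum_def increasing_trees_1 by simp

lemma total_weight_pos:
  assumes "n \<ge> 1" "c1 > 0" "alpha c1 c2 > 0"
  shows "weighted_sum c1 c2 n (\<lambda>_. 1) > 0"
proof -
  obtain N where "n = 1 + N" using assms(1) le_Suc_ex by blast
  then have "weighted_sum c1 c2 n (\<lambda>_. 1) = c1 ^ N * pochhammer (alpha c1 c2) N"
    using total_weight_growth[of 1 c1 c2 N] total_weight_1[of c1 c2] assms(2) by (simp del: One_nat_def)
  also have "\<dots> > 0" using assms by (intro mult_pos_pos pochhammer_pos) auto
  finally show ?thesis .
qed

lemma last_label_is_leaf:
  assumes "recursive_tree n E"
  shows "E `` {n} = {}"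
  using assms by (fastforce simp: recursive_tree_def)

text \<open>The subtree of \<open>m + 2\<close> is born with size 1 in the tree of size \<open>m + 2\<close>. Of the \<open>N\<close> later nodes,
\<open>j\<close> enter the subtree, at one of \<open>N choose j\<close> sets of times; the weights of the entries multiply to a rising
factorial of \<open>\<alpha>\<close>, those of the other nodes to \<open>(m + 1) (m + 2) \<cdots> (m + N - j)\<close>. The proof verifies this
by the rule of Pascal. The root is excluded, as its subtree is the whole tree.\<close>
lemma subtree_weight_growth:
  assumes c1: "c1 > 0"
  shows "weighted_sum c1 c2 (m + 2 + N) (\<lambda>E. of_bool (subtree_size E (m + 2) = Suc j)) =
    weighted_sum c1 c2 (m + 2) (\<lambda>_. 1) * c1 ^ N *
      (real (N choose j) * pochhammer (alpha c1 c2) j * fact (N + m - j) / fact m)"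
proof (induction N arbitrary: j)
  case 0
  have "subtree_size E (m + 2) = 1" if E: "recursive_tree (m + 2) E" for E
  proof -
    have "E\<^sup>* `` {m + 2} = {m + 2}"
      using last_label_is_leaf[OF E] by (auto elim: converse_rtranclE)
    then show ?thesis by (simp add: subtree_size_def)
  qed
  then have "weighted_sum c1 c2 (m + 2) (\<lambda>E. of_bool (subtree_size E (m + 2) = Suc j)) =
      weighted_sum c1 c2 (m + 2) (\<lambda>E. of_bool (j = 0) * 1)"
    by (intro weighted_sum_cong) auto
  then show ?case unfolding weighted_sum_cmult by (cases j) auto
next
  case (Suc N)
  let ?a = "alpha c1 c2" let ?n = "m + 2 + N" let ?k = "m + 2"
  let ?U = "\<lambda>j. weighted_sum c1 c2 ?n (\<lambda>E. of_bool (subtree_size E ?k = Suc j))"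
  let ?A = "weighted_sum c1 c2 (m + 2) (\<lambda>_. 1) * c1 ^ N / fact m"
  have n: "?n \<ge> 1" and k: "?k \<in> {1..?n}" by auto
  have "weighted_sum c1 c2 (Suc ?n) (\<lambda>E. of_bool (subtree_size E ?k = Suc j)) =
     c1 * weighted_sum c1 c2 ?n (\<lambda>E. \<Sum>v\<in>{1..?n}. attach_weight ?a E v *
        of_bool (subtree_size (insert (v, Suc ?n) E) ?k = Suc j))"
    by (rule weighted_sum_Suc[OF n c1])
  also have "weighted_sum c1 c2 ?n (\<lambda>E. \<Sum>v\<in>{1..?n}. attach_weight ?a E v *
        of_bool (subtree_size (insert (v, Suc ?n) E) ?k = Suc j)) =
    weighted_sum c1 c2 ?n (\<lambda>E. (real (Suc j) + ?a - 2) * of_bool (subtree_size E ?k = j)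
      + (real ?n - real (Suc j)) * of_bool (subtree_size E ?k = Suc j))"
    using subtree_size_growth[OF _ k] by (intro weighted_sum_cong[OF n]) simp
  also have "\<dots> = (real j + ?a - 1) * weighted_sum c1 c2 ?n (\<lambda>E. of_bool (subtree_size E ?k = j))
      + (real (N + m + 1) - real j) * ?U j"
    unfolding weighted_sum_add weighted_sum_cmult by simp
  also have "(real j + ?a - 1) * weighted_sum c1 c2 ?n (\<lambda>E. of_bool (subtree_size E ?k = j)) =
     ?A * (if j = 0 then 0 else real (N choose (j - 1))) * pochhammer ?a j * fact (Suc N + m - j)"
  proof (cases j)
    case 0
    have "weighted_sum c1 c2 ?n (\<lambda>E. of_bool (subtree_size E ?k = 0)) = weighted_sum c1 c2 ?n (\<lambda>E. 0 * 1)"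
      using subtree_size_pos[OF _ k] by (intro weighted_sum_cong[OF n]) auto
    then show ?thesis using 0 by (simp only: weighted_sum_cmult) simp
  next
    case (Suc i)
    then show ?thesis using Suc.IH[of i] by (simp add: pochhammer_Suc algebra_simps add_divide_distrib)
  qed
  also have "(real (N + m + 1) - real j) * ?U j = ?A * real (N choose j) * pochhammer ?a j * fact (Suc N + m - j)"
  proof (cases "j \<le> N")
    case True
    then have "fact (Suc N + m - j) = (real (N + m + 1) - real j) * fact (N + m - j)"
      by (simp add: Suc_diff_le of_nat_diff)
    then show ?thesis using Suc.IH[of j] by simp
  next
    case False
    then show ?thesis using Suc.IH[of j] by simp
  qed
  also have "?A * (if j = 0 then 0 else real (N choose (j - 1))) * pochhammer ?a j * fact (Suc N + m - j)
     + ?A * real (N choose j) * pochhammer ?a j * fact (Suc N + m - j) =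
     ?A * real (Suc N choose j) * pochhammer ?a j * fact (Suc N + m - j)"
    by (cases j) (simp_all add: algebra_simps add_divide_distrib)
  finally show ?case by simp
qed

lemma node_attach_weight_growth:
  assumes c1: "c1 > 0"
  shows "weighted_sum c1 c2 (Suc m + N) (\<lambda>E. attach_weight (alpha c1 c2) E (Suc m)) =
    alpha c1 c2 * weighted_sum c1 c2 (Suc m) (\<lambda>_. 1) * c1 ^ N * (fact (N + m) / fact m)"
proof (induction N)
  case 0
  let ?a = "alpha c1 c2"
  have "weighted_sum c1 c2 (Suc m) (\<lambda>E. attach_weight ?a E (Suc m)) = weighted_sum c1 c2 (Suc m) (\<lambda>E. ?a * 1)"
    using last_label_is_leaf by (intro weighted_sum_cong) (auto simp: attach_weight_def)
  then show ?case unfolding weighted_sum_cmult by simp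
next
  case (Suc N)
  let ?a = "alpha c1 c2" let ?n = "Suc m + N" let ?k = "Suc m"
  have n: "?n \<ge> 1" and k: "?k \<in> {1..?n}" by auto
  have "weighted_sum c1 c2 (Suc ?n) (\<lambda>E. attach_weight ?a E ?k) =
     c1 * weighted_sum c1 c2 ?n (\<lambda>E. \<Sum>v\<in>{1..?n}. attach_weight ?a E v *
        attach_weight ?a (insert (v, Suc ?n) E) ?k)"
    by (rule weighted_sum_Suc[OF n c1])
  also have "weighted_sum c1 c2 ?n (\<lambda>E. \<Sum>v\<in>{1..?n}. attach_weight ?a E v *
        attach_weight ?a (insert (v, Suc ?n) E) ?k) =
    weighted_sum c1 c2 ?n (\<lambda>E. real ?n * attach_weight ?a E ?k)"
    by (intro weighted_sum_cong[OF n] attach_weight_growth[OF _ k])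
  finally show ?case using Suc.IH unfolding weighted_sum_cmult by (simp add: algebra_simps add_divide_distrib)
qed

text \<open>A child of \<open>m + 1\<close> is created by one of the \<open>N\<close> later nodes and its subtree receives \<open>j\<close> nodes after that;
the binomial coefficient \<open>N choose (j + 1)\<close> arises as the sum over the time of creation.\<close>
lemma child_weight_growth:
  assumes c1: "c1 > 0"
  shows "weighted_sum c1 c2 (Suc m + N) (\<lambda>E. \<Sum>c\<in>E `` {Suc m}. of_bool (subtree_size E c = Suc j)) =
    alpha c1 c2 * weighted_sum c1 c2 (Suc m) (\<lambda>_. 1) * c1 ^ N *
      (real (N choose Suc j) * pochhammer (alpha c1 c2) j * fact (N + m - Suc j) / fact m)"
proof (induction N arbitrary: j)
  case 0
  have "weighted_sum c1 c2 (Suc m) (\<lambda>E. \<Sum>c\<in>E `` {Suc m}. of_bool (subtree_size E c = Suc j)) =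
      weighted_sum c1 c2 (Suc m) (\<lambda>E. 0 * 1)"
    using last_label_is_leaf by (intro weighted_sum_cong) auto
  then show ?case unfolding weighted_sum_cmult by simp
next
  case (Suc N)
  let ?a = "alpha c1 c2" let ?n = "Suc m + N" let ?k = "Suc m"
  let ?h = "\<lambda>s E. \<Sum>c\<in>E `` {?k}. of_bool (subtree_size E c = s) :: real"
  let ?V = "\<lambda>s. weighted_sum c1 c2 ?n (?h s)"
  let ?A = "?a * weighted_sum c1 c2 (Suc m) (\<lambda>_. 1) * c1 ^ N / fact m"
  have n: "?n \<ge> 1" and k: "?k \<in> {1..?n}" by auto
  have "weighted_sum c1 c2 (Suc ?n) (?h (Suc j)) =
     c1 * weighted_sum c1 c2 ?n (\<lambda>E. \<Sum>v\<in>{1..?n}. attach_weight ?a E v *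
        ?h (Suc j) (insert (v, Suc ?n) E))"
    by (rule weighted_sum_Suc[OF n c1])
  also have "weighted_sum c1 c2 ?n (\<lambda>E. \<Sum>v\<in>{1..?n}. attach_weight ?a E v *
        ?h (Suc j) (insert (v, Suc ?n) E)) =
    weighted_sum c1 c2 ?n (\<lambda>E. (real (Suc j) + ?a - 2) * ?h j E
      + (real ?n - real (Suc j)) * ?h (Suc j) E + of_bool (Suc j = 1) * attach_weight ?a E ?k)"
    using child_sizes_growth[OF _ k] by (intro weighted_sum_cong[OF n]) simp
  also have "\<dots> = (real j + ?a - 1) * ?V j + (real (N + m) - real j) * ?V (Suc j)
      + of_bool (j = 0) * weighted_sum c1 c2 ?n (\<lambda>E. attach_weight ?a E ?k)"
    unfolding weighted_sum_add weighted_sum_cmult by simp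
  also have "(real (N + m) - real j) * ?V (Suc j) = ?A * real (N choose Suc j) * pochhammer ?a j * fact (N + m - j)"
  proof (cases "Suc j \<le> N")
    case True
    then have "N + m - j = Suc (N + m - Suc j)" by simp
    then have "fact (N + m - j) = (real (N + m) - real j) * fact (N + m - Suc j)"
      using True by (simp add: of_nat_diff)
    then show ?thesis using Suc.IH[of j] by simp
  next
    case False
    then show ?thesis using Suc.IH[of j] by simp
  qed
  also have "(real j + ?a - 1) * ?V j + ?A * real (N choose Suc j) * pochhammer ?a j * fact (N + m - j)
      + of_bool (j = 0) * weighted_sum c1 c2 ?n (\<lambda>E. attach_weight ?a E ?k) =
    ?A * real (Suc N choose Suc j) * pochhammer ?a j * fact (N + m - j)"
  proof (cases j)
    case 0
    have "?V 0 = weighted_sum c1 c2 ?n (\<lambda>E. 0 * 1)"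
    proof (rule weighted_sum_cong[OF n])
      fix E assume E: "recursive_tree ?n E"
      have "subtree_size E c \<noteq> 0" if "c \<in> E `` {?k}" for c
        using subtree_size_pos[OF E] children_subset[OF E] that by blast
      then show "?h 0 E = 0 * 1" by (simp add: sum.neutral)
    qed
    then have "?V 0 = 0" unfolding weighted_sum_cmult by simp
    then show ?thesis using 0 node_attach_weight_growth[OF c1, of c2 m N] by (simp add: algebra_simps add_divide_distrib)
  next
    case (Suc i)
    then show ?thesis using Suc.IH[of i] by (simp add: pochhammer_Suc algebra_simps add_divide_distrib)
  qed
  finally show ?case by simp
qed

section \<open>The exact law of the centroid label\<close>

text \<open>For \<open>g > 1\<close> this is, up to a constant factor that depends on \<open>m\<close> and \<open>g\<close>, the upper tail of a
beta-binomial law. The size of a subtree leads to \<open>g = \<alpha> + 1\<close> and the children of a node lead to \<open>g = \<alpha>\<close>.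
If \<open>g = \<alpha> \<le> 1\<close>, the first argument of the beta function would not be positive at
\<open>i = 0\<close>, but \<open>N + b < 2 i\<close> excludes this index.\<close>
definition upper_beta_sum :: "nat \<Rightarrow> nat \<Rightarrow> real \<Rightarrow> nat \<Rightarrow> real" where
  "upper_beta_sum b m g N = 
     (\<Sum>i | i \<le> N \<and> N + b < 2 * i. real (N choose i) * Beta (g - 1 + real i) (real (N - i + m + 1)))"

lemma Beta_shift:
  fixes a :: real
  assumes "a > 0"
  shows "Beta (a + real j) (real (p + 1)) = pochhammer a j * fact p / pochhammer a (j + p + 1)"
proof -
  have a: "a \<notin> \<int>\<^sub>\<le>\<^sub>0" using assms by (auto elim!: nonpos_Ints_cases)
  have G: "Gamma (a + real i) = pochhammer a i * Gamma a" for i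
    using pochhammer_Gamma[OF a, of i] Gamma_real_pos[OF assms] by simp
  have "Gamma (real (p + 1)) = fact p" using Gamma_fact[of p, where 'a=real] by (simp add: add.commute)
  moreover have "a + real j + real (p + 1) = a + real (j + p + 1)" by simp
  ultimately show ?thesis using Gamma_real_pos[OF assms] unfolding Beta_def by (simp only: G) simp
qed

lemma subtree_size_prob:
  assumes c1: "c1 > 0" and a: "alpha c1 c2 > 0"
  shows "weighted_sum c1 c2 (m + 2 + N) (\<lambda>E. of_bool (subtree_size E (m + 2) = Suc j)) /
      weighted_sum c1 c2 (m + 2 + N) (\<lambda>_. 1) =
    alpha c1 c2 * pochhammer (alpha c1 c2 + 1) m / fact m *
      (real (N choose j) * Beta (alpha c1 c2 + real j) (real (N - j + m + 1)))"
proof (cases "j \<le> N")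
  case True
  let ?a = "alpha c1 c2"
  have Z: "weighted_sum c1 c2 (m + 2) (\<lambda>_. 1) > 0" using total_weight_pos[OF _ c1 a] by simp
  have "j + (N - j + m) + 1 = Suc m + N" using True by simp
  then have "pochhammer ?a (j + (N - j + m) + 1) = ?a * pochhammer (?a + 1) m * pochhammer (?a + real m + 1) N"
    using pochhammer_product'[of ?a "Suc m" N] by (simp add: pochhammer_rec algebra_simps)
  moreover have "N + m - j = N - j + m" using True by simp
  moreover have "pochhammer (?a + 1) m > 0" "pochhammer (?a + real m + 1) N > 0"
    using a by (auto intro!: pochhammer_pos)
  moreover have "weighted_sum c1 c2 (m + 2 + N) (\<lambda>_. 1) = 
      weighted_sum c1 c2 (m + 2) (\<lambda>_. 1) * c1 ^ N * pochhammer (?a + real m + 1) N"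
    using total_weight_growth[of "m + 2" c1 c2 N] c1 by (simp add: algebra_simps)
  ultimately show ?thesis
    unfolding subtree_weight_growth[OF c1] Beta_shift[OF a] using Z c1 a by (simp add: field_simps)
next
  case False
  then have zero: "N choose j = 0" by simp
  show ?thesis unfolding subtree_weight_growth[OF c1] zero by simp
qed

lemma child_size_prob:
  assumes c1: "c1 > 0" and a: "alpha c1 c2 > 0"
  shows "weighted_sum c1 c2 (Suc m + N) (\<lambda>E. \<Sum>c\<in>E `` {Suc m}. of_bool (subtree_size E c = Suc j)) /
      weighted_sum c1 c2 (Suc m + N) (\<lambda>_. 1) =
    alpha c1 c2 * pochhammer (alpha c1 c2) m / fact m *
      (real (N choose Suc j) * Beta (alpha c1 c2 + real j) (real (N - Suc j + m + 1)))"
proof (cases "Suc j \<le> N")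
  case True
  let ?a = "alpha c1 c2"
  have Z: "weighted_sum c1 c2 (Suc m) (\<lambda>_. 1) > 0" using total_weight_pos[OF _ c1 a] by simp
  have "j + (N - Suc j + m) + 1 = m + N" using True by simp
  then have "pochhammer ?a (j + (N - Suc j + m) + 1) = pochhammer ?a m * pochhammer (?a + real m) N"
    using pochhammer_product'[of ?a m N] by (simp only:)
  moreover have "N + m - Suc j = N - Suc j + m" using True by simp
  moreover have "pochhammer ?a m > 0" "pochhammer (?a + real m) N > 0"
    using a by (auto intro!: pochhammer_pos)
  moreover have "weighted_sum c1 c2 (Suc m + N) (\<lambda>_. 1) = 
      weighted_sum c1 c2 (Suc m) (\<lambda>_. 1) * c1 ^ N * pochhammer (?a + real m) N"
    using total_weight_growth[of "Suc m" c1 c2 N] c1 by (simp add: algebra_simps)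
  ultimately show ?thesis
    unfolding child_weight_growth[OF c1] Beta_shift[OF a] using Z c1 a by (simp add: field_simps)
next
  case False
  then have zero: "N choose Suc j = 0" by simp
  show ?thesis unfolding child_weight_growth[OF c1] zero by simp
qed

text \<open>Subtrees of distinct children of \<open>k\<close> are disjoint: if one of the two were an ancestor of the other, it
would be an ancestor of their common parent \<open>k\<close>, contradicting the order of the labels.\<close>
lemma heavy_child_unique:
  assumes E: "recursive_tree n E" and c: "c \<in> E `` {k}" "c' \<in> E `` {k}"
    and h: "n < 2 * subtree_size E c" "n < 2 * subtree_size E c'"
  shows "c = c'"
proof -
  have n: "c \<in> {1..n}" "c' \<in> {1..n}" using children_subset[OF E] c by blast+
  note D = recursive_tree_descendants_subset[OF E n(1)] recursive_tree_descendants_subset[OF E n(2)]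
  have "E\<^sup>* `` {c} \<inter> E\<^sup>* `` {c'} \<noteq> {}"
  proof
    assume dis: "E\<^sup>* `` {c} \<inter> E\<^sup>* `` {c'} = {}"
    have "card (E\<^sup>* `` {c} \<union> E\<^sup>* `` {c'}) \<le> card {1..n}" using D by (intro card_mono) auto
    then have "subtree_size E c + subtree_size E c' \<le> n"
      using card_Un_disjoint[OF finite_subset[OF D(1)] finite_subset[OF D(2)] dis]
      by (simp add: subtree_size_def)
    then show False using h by simp
  qed
  then obtain w where w: "(c, w) \<in> E\<^sup>*" "(c', w) \<in> E\<^sup>*" by auto
  have eq: "x = y" if xy: "(x, y) \<in> E\<^sup>*" "(k, x) \<in> E" "(k, y) \<in> E" for x y
  proof (rule ccontr)
    assume "x \<noteq> y"
    then obtain z where z: "(x, z) \<in> E\<^sup>*" "(z, y) \<in> E" using xy(1) by (auto elim: rtranclE)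
    then have "z = k" using recursive_tree_parent_unique[OF E _ xy(3)] by blast
    then show False using recursive_tree_rtrancl_le[OF E z(1)] recursive_tree_less[OF E xy(2)] by simp
  qed
  have kc: "(k, c) \<in> E" "(k, c') \<in> E" using c by auto
  show ?thesis
  proof (cases "c \<le> c'")
    case True
    then show ?thesis using eq[OF recursive_tree_ancestors_comparable[OF E w True] kc] by simp
  next
    case False
    then have "c' \<le> c" by simp
    then show ?thesis using eq[OF recursive_tree_ancestors_comparable[OF E w(2,1)] kc(2,1)] by simp
  qed
qed

text \<open>The number of heavy children is 0 or 1, and it is 0 if \<open>k\<close> itself is not heavy; so the difference is
an indicator, and its expectation splits into two quantities that the urn describes.\<close>
lemma centroid_indicator:
  assumes E: "recursive_tree n E" and k: "k \<in> {1..n}"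
  shows "of_bool (n < 2 * subtree_size E k \<and> (\<forall>c\<in>E `` {k}. 2 * subtree_size E c \<le> n)) =
    of_bool (n < 2 * subtree_size E k) - (\<Sum>c\<in>E `` {k}. of_bool (n < 2 * subtree_size E c) :: real)"
proof (cases "\<exists>c\<in>E `` {k}. n < 2 * subtree_size E c")
  case True
  then obtain c where c: "c \<in> E `` {k}" "n < 2 * subtree_size E c" by blast
  have "(k, c) \<in> E\<^sup>*" using c by auto
  then have "n < 2 * subtree_size E k" using subtree_size_mono[OF E k] c(2) by fastforce
  moreover have "(\<Sum>d\<in>E `` {k}. of_bool (n < 2 * subtree_size E d)) =
      (\<Sum>d\<in>E `` {k}. if d = c then 1 else 0 :: real)"
  proof (intro sum.cong refl)
    fix d assume d: "d \<in> E `` {k}"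
    have "n < 2 * subtree_size E d \<longleftrightarrow> d = c" using heavy_child_unique[OF E d c(1) _ c(2)] c(2) by blast
    then show "of_bool (n < 2 * subtree_size E d) = (if d = c then 1 else 0 :: real)" by simp
  qed
  then have "(\<Sum>d\<in>E `` {k}. of_bool (n < 2 * subtree_size E d)) = (1 :: real)"
    using c(1) finite_recursive_tree_children[OF E, of k] by simp
  moreover have "\<not> (\<forall>c\<in>E `` {k}. 2 * subtree_size E c \<le> n)" using c by (meson not_le)
  ultimately show ?thesis by simp
next
  case False
  then have "(\<Sum>c\<in>E `` {k}. of_bool (n < 2 * subtree_size E c)) = (0 :: real)" by (intro sum.neutral) auto
  moreover have "\<forall>c\<in>E `` {k}. 2 * subtree_size E c \<le> n" using False by (meson not_le)
  ultimately show ?thesis by simp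
qed

lemma subtree_size_le:
  assumes "recursive_tree n E" "k \<in> {1..n}"
  shows "subtree_size E k \<le> n"
  using card_mono[OF finite_atLeastAtMost recursive_tree_descendants_subset[OF assms]]
  by (simp add: subtree_size_def)

lemma heavy_indicator:
  assumes E: "recursive_tree n E" and k: "k \<in> {1..n}"
  shows "of_bool (n < 2 * subtree_size E k) = 
    (\<Sum>j | j < n \<and> n < 2 * Suc j. of_bool (subtree_size E k = Suc j) :: real)"
proof -
  \<comment> \<open>Sizes are counted as \<open>Suc j\<close> because the urn starts with one node and \<open>j\<close> nodes enter later.\<close>
  obtain i where i: "subtree_size E k = Suc i" using subtree_size_pos[OF E k] by (cases "subtree_size E k") auto
  have "i < n" using subtree_size_le[OF E k] i by simp
  let ?J = "{j. j < n \<and> n < 2 * Suc j}"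
  have "finite ?J" by simp
  have "(\<Sum>j | j < n \<and> n < 2 * Suc j. of_bool (subtree_size E k = Suc j) :: real) =
      (\<Sum>j | j < n \<and> n < 2 * Suc j. if j = i then 1 else 0)"
    using i by (intro sum.cong) auto
  also have "\<dots> = of_bool (n < 2 * Suc i)" using \<open>i < n\<close> by (simp only: sum.delta[OF \<open>finite ?J\<close>]) simp
  finally show ?thesis using i by simp
qed

text \<open>The embedding of the weights as a probability mass function is meaningful because the weights are
nonnegative and their sum over the trees of size \<open>n\<close> is positive.\<close>
lemma random_tree_prob:
  assumes fam: "very_simple_family c1 c2" and n: "n \<ge> 1" and a: "alpha c1 c2 > 0"
  shows "measure_pmf.prob (random_tree c1 c2 n) A = 
    (\<Sum>T\<in>increasing_trees n \<inter> A. tree_weight c1 c2 T) / weighted_sum c1 c2 n (\<lambda>_. 1)"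
proof -
  let ?Z = "weighted_sum c1 c2 n (\<lambda>_. 1)" let ?I = "increasing_trees n"
  let ?f = "\<lambda>T. if T \<in> ?I then tree_weight c1 c2 T / ?Z else 0"
  have c1: "c1 > 0" using fam by (simp add: very_simple_family_def)
  have Z: "?Z > 0" by (rule total_weight_pos[OF n c1 a])
  have Zeq: "?Z = (\<Sum>S\<in>?I. tree_weight c1 c2 S)" by (simp add: weighted_sum_def)
  have fin: "finite ?I" by (rule finite_increasing_trees[OF n])
  have nonneg: "?f T \<ge> 0" for T using tree_weight_nonneg[OF fam] Z by simp
  have "(\<integral>\<^sup>+ T. ennreal (?f T) \<partial>count_space UNIV) = (\<Sum>T\<in>?I. ennreal (?f T))"
    using fin by (intro nn_integral_count_space') auto
  also have "\<dots> = ennreal (\<Sum>T\<in>?I. ?f T)" using nonneg by (intro sum_ennreal) 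
  also have "(\<Sum>T\<in>?I. ?f T) = (\<Sum>T\<in>?I. tree_weight c1 c2 T) / ?Z"
    by (simp add: sum_divide_distrib)
  finally have one: "(\<integral>\<^sup>+ T. ennreal (?f T) \<partial>count_space UNIV) = 1" using Z Zeq by simp
  have pmf: "pmf (random_tree c1 c2 n) T = ?f T" for T
    unfolding random_tree_def Zeq[symmetric] using pmf_embed_pmf[OF nonneg one] .
  have "set_pmf (random_tree c1 c2 n) \<subseteq> ?I" using pmf by (auto simp: set_pmf_iff split: if_splits)
  then have "A \<inter> set_pmf (random_tree c1 c2 n) = (?I \<inter> A) \<inter> set_pmf (random_tree c1 c2 n)" by blast
  then have "measure_pmf.prob (random_tree c1 c2 n) A = measure_pmf.prob (random_tree c1 c2 n) (?I \<inter> A)"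
    by (metis measure_Int_set_pmf)
  also have "\<dots> = (\<Sum>T\<in>?I \<inter> A. pmf (random_tree c1 c2 n) T)"
    using fin by (intro measure_measure_pmf_finite) auto
  also have "\<dots> = (\<Sum>T\<in>?I \<inter> A. tree_weight c1 c2 T / ?Z)" unfolding pmf by (intro sum.cong) auto
  finally show ?thesis by (simp add: sum_divide_distrib)
qed

lemma centroid_prob_weighted_sum:
  assumes fam: "very_simple_family c1 c2" and a: "alpha c1 c2 > 0" and k: "k \<in> {1..n}"
  shows "measure_pmf.prob (random_tree c1 c2 n) {T. centroid_label T = k} =
    (weighted_sum c1 c2 n (\<lambda>E. of_bool (n < 2 * subtree_size E k)) -
     weighted_sum c1 c2 n (\<lambda>E. \<Sum>c\<in>E `` {k}. of_bool (n < 2 * subtree_size E c)))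
    / weighted_sum c1 c2 n (\<lambda>_. 1)"
proof -
  have n: "n \<ge> 1" using k by simp
  let ?P = "\<lambda>E. n < 2 * subtree_size E k \<and> (\<forall>c\<in>E `` {k}. 2 * subtree_size E c \<le> n)"
  let ?A = "{T. centroid_label T = k}"
  have fin: "finite (increasing_trees n)" by (rule finite_increasing_trees[OF n])
  have "(\<Sum>T\<in>increasing_trees n \<inter> ?A. tree_weight c1 c2 T) =
      (\<Sum>T\<in>increasing_trees n. if T \<in> ?A then tree_weight c1 c2 T else 0)"
    by (rule sum.inter_restrict[OF fin])
  also have "\<dots> = weighted_sum c1 c2 n (\<lambda>E. of_bool (?P E))"
    unfolding weighted_sum_def
  proof (intro sum.cong refl)
    fix T assume T: "T \<in> increasing_trees n"
    have "T \<in> ?A \<longleftrightarrow> ?P (tree_edges T)" using centroid_label_iff[OF n T, of k] k by blast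
    then show "(if T \<in> ?A then tree_weight c1 c2 T else 0) = 
        tree_weight c1 c2 T * of_bool (?P (tree_edges T))" by (simp only: of_bool_def) simp
  qed
  also have "\<dots> = weighted_sum c1 c2 n (\<lambda>E. of_bool (n < 2 * subtree_size E k) - 
      (\<Sum>c\<in>E `` {k}. of_bool (n < 2 * subtree_size E c)))"
    by (intro weighted_sum_cong[OF n] centroid_indicator[OF _ k])
  finally show ?thesis unfolding random_tree_prob[OF fam n a] weighted_sum_diff by simp
qed

lemma heavy_subtree_prob:
  assumes c1: "c1 > 0" and a: "alpha c1 c2 > 0"
  shows "weighted_sum c1 c2 (m + 2 + N) (\<lambda>E. of_bool (m + 2 + N < 2 * subtree_size E (m + 2))) /
      weighted_sum c1 c2 (m + 2 + N) (\<lambda>_. 1) =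
    alpha c1 c2 * pochhammer (alpha c1 c2 + 1) m / fact m * upper_beta_sum m m (alpha c1 c2 + 1) N"
proof -
  let ?n = "m + 2 + N" let ?a = "alpha c1 c2" let ?J = "{j. j < ?n \<and> ?n < 2 * Suc j}"
  let ?t = "\<lambda>j. real (N choose j) * Beta (?a + real j) (real (N - j + m + 1))"
  have eq: "weighted_sum c1 c2 ?n (\<lambda>E. of_bool (?n < 2 * subtree_size E (m + 2))) =
      weighted_sum c1 c2 ?n (\<lambda>E. \<Sum>j\<in>?J. of_bool (subtree_size E (m + 2) = Suc j))"
    by (intro weighted_sum_cong heavy_indicator) auto
  have "weighted_sum c1 c2 ?n (\<lambda>E. of_bool (?n < 2 * subtree_size E (m + 2))) /
      weighted_sum c1 c2 ?n (\<lambda>_. 1) = ?a * pochhammer (?a + 1) m / fact m * (\<Sum>j\<in>?J. ?t j)"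
    unfolding eq weighted_sum_sum sum_divide_distrib sum_distrib_left
    by (intro sum.cong refl subtree_size_prob[OF c1 a])
  also have "(\<Sum>j\<in>?J. ?t j) = (\<Sum>j | j \<le> N \<and> N + m < 2 * j. ?t j)"
  proof (intro sum.mono_neutral_right ballI)
    show "finite ?J" by (rule finite_subset[of _ "{..<?n}"]) (blast, rule finite_lessThan)
    show "{j. j \<le> N \<and> N + m < 2 * j} \<subseteq> ?J" by auto
    fix i assume "i \<in> ?J - {j. j \<le> N \<and> N + m < 2 * j}"
    then have "N < i" by auto
    then have "N choose i = 0" by simp
    then show "?t i = 0" by (simp only: of_nat_0 mult_zero_left)
  qed
  also have "\<dots> = upper_beta_sum m m (?a + 1) N" by (simp add: upper_beta_sum_def)
  finally show ?thesis .
qed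

lemma heavy_child_prob:
  assumes c1: "c1 > 0" and a: "alpha c1 c2 > 0"
  shows "weighted_sum c1 c2 (Suc m + N) (\<lambda>E. \<Sum>c\<in>E `` {Suc m}. of_bool (Suc m + N < 2 * subtree_size E c)) /
      weighted_sum c1 c2 (Suc m + N) (\<lambda>_. 1) =
    alpha c1 c2 * pochhammer (alpha c1 c2) m / fact m * upper_beta_sum (m + 1) m (alpha c1 c2) N"
proof -
  let ?n = "Suc m + N" let ?a = "alpha c1 c2" let ?J = "{j. j < ?n \<and> ?n < 2 * Suc j}"
  let ?t = "\<lambda>i. real (N choose i) * Beta (?a - 1 + real i) (real (N - i + m + 1))"
  have "(\<Sum>c\<in>E `` {Suc m}. of_bool (?n < 2 * subtree_size E c)) =
      (\<Sum>j\<in>?J. \<Sum>c\<in>E `` {Suc m}. of_bool (subtree_size E c = Suc j) :: real)"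
    if E: "recursive_tree ?n E" for E
  proof -
    have "(\<Sum>c\<in>E `` {Suc m}. of_bool (?n < 2 * subtree_size E c)) =
      (\<Sum>c\<in>E `` {Suc m}. \<Sum>j\<in>?J. of_bool (subtree_size E c = Suc j) :: real)"
      using children_subset[OF E, of "Suc m"] by (intro sum.cong refl heavy_indicator[OF E]) blast
    also have "\<dots> = (\<Sum>j\<in>?J. \<Sum>c\<in>E `` {Suc m}. of_bool (subtree_size E c = Suc j) :: real)"
      by (rule sum.swap)
    finally show ?thesis .
  qed
  then have eq: "weighted_sum c1 c2 ?n (\<lambda>E. \<Sum>c\<in>E `` {Suc m}. of_bool (?n < 2 * subtree_size E c)) =
      weighted_sum c1 c2 ?n (\<lambda>E. \<Sum>j\<in>?J. \<Sum>c\<in>E `` {Suc m}. of_bool (subtree_size E c = Suc j))"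
    by (intro weighted_sum_cong) auto
  have "weighted_sum c1 c2 ?n (\<lambda>E. \<Sum>c\<in>E `` {Suc m}. of_bool (?n < 2 * subtree_size E c)) /
      weighted_sum c1 c2 ?n (\<lambda>_. 1) = ?a * pochhammer ?a m / fact m * (\<Sum>j\<in>?J. ?t (Suc j))"
    unfolding eq weighted_sum_sum sum_divide_distrib sum_distrib_left
    by (intro sum.cong refl) (subst child_size_prob[OF c1 a], simp add: algebra_simps)
  also have "(\<Sum>j\<in>?J. ?t (Suc j)) = (\<Sum>i\<in>Suc ` ?J. ?t i)"
    by (simp add: sum.reindex)
  also have "\<dots> = (\<Sum>i | i \<le> N \<and> N + (m + 1) < 2 * i. ?t i)"
  proof (intro sum.mono_neutral_right ballI)
    show "finite (Suc ` ?J)"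
      by (rule finite_imageI, rule finite_subset[of _ "{..<?n}"]) (blast, rule finite_lessThan)
    show "{i. i \<le> N \<and> N + (m + 1) < 2 * i} \<subseteq> Suc ` ?J"
    proof
      fix i assume "i \<in> {i. i \<le> N \<and> N + (m + 1) < 2 * i}"
      then have i: "i \<le> N" "N + (m + 1) < 2 * i" by blast+
      then have "i - 1 \<in> ?J" by auto
      moreover have "i = Suc (i - 1)" using i by linarith
      ultimately show "i \<in> Suc ` ?J" by blast
    qed
    fix i assume i: "i \<in> Suc ` ?J - {i. i \<le> N \<and> N + (m + 1) < 2 * i}"
    then obtain j where "i = Suc j" "j \<in> ?J" by blast
    then have "N < i" using i by auto
    then have "N choose i = 0" by simp
    then show "?t i = 0" by (simp only: of_nat_0 mult_zero_left)
  qed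
  also have "\<dots> = upper_beta_sum (m + 1) m ?a N" by (simp add: upper_beta_sum_def)
  finally show ?thesis .
qed

text \<open>For \<open>k = 1\<close> the first term is 1, since the root is always heavy.\<close>
theorem centroid_prob_finite:
  assumes fam: "very_simple_family c1 c2" and a: "alpha c1 c2 > 0"
  shows "measure_pmf.prob (random_tree c1 c2 (1 + N)) {T. centroid_label T = 1} =
      1 - alpha c1 c2 * upper_beta_sum 1 0 (alpha c1 c2) N"
    and "measure_pmf.prob (random_tree c1 c2 (m + 2 + N)) {T. centroid_label T = m + 2} =
      alpha c1 c2 * pochhammer (alpha c1 c2 + 1) m / fact m * upper_beta_sum m m (alpha c1 c2 + 1) N
      - alpha c1 c2 * pochhammer (alpha c1 c2) (m + 1) / fact (m + 1)
          * upper_beta_sum (m + 2) (m + 1) (alpha c1 c2) N"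
proof -
  have c1: "c1 > 0" using fam by (simp add: very_simple_family_def)
  have Z: "weighted_sum c1 c2 (1 + N) (\<lambda>_. 1) > 0" using total_weight_pos[OF _ c1 a] by simp
  have "weighted_sum c1 c2 (1 + N) (\<lambda>E. of_bool (1 + N < 2 * subtree_size E 1)) = 
      weighted_sum c1 c2 (1 + N) (\<lambda>_. 1)"
    using subtree_size_root[of "1 + N"] by (intro weighted_sum_cong) auto
  then show "measure_pmf.prob (random_tree c1 c2 (1 + N)) {T. centroid_label T = 1} =
      1 - alpha c1 c2 * upper_beta_sum 1 0 (alpha c1 c2) N"
    using centroid_prob_weighted_sum[OF fam a, of 1 "1 + N"] heavy_child_prob[OF c1 a, of 0 N] Z
    by (simp add: diff_divide_distrib)
  have "Suc (m + 1) + N = m + 2 + N" "Suc (m + 1) = m + 2" "m + 1 + 1 = m + 2" by auto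
  then show "measure_pmf.prob (random_tree c1 c2 (m + 2 + N)) {T. centroid_label T = m + 2} =
      alpha c1 c2 * pochhammer (alpha c1 c2 + 1) m / fact m * upper_beta_sum m m (alpha c1 c2 + 1) N
      - alpha c1 c2 * pochhammer (alpha c1 c2) (m + 1) / fact (m + 1)
          * upper_beta_sum (m + 2) (m + 1) (alpha c1 c2) N"
    using centroid_prob_weighted_sum[OF fam a, of "m + 2" "m + 2 + N"]
      heavy_child_prob[OF c1 a, of "m + 1" N] heavy_subtree_prob[OF c1 a, of m N]
    by (simp only: diff_divide_distrib) simp
qed

section \<open>Binomial tails and the limit law\<close>

text \<open>The probability that a binomial variable with parameters \<open>N\<close> and \<open>x\<close> exceeds \<open>(N + b) / 2\<close>: the
polynomials \<open>Bernstein N i x\<close> are the binomial probabilities.\<close>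
definition upper_tail :: "nat \<Rightarrow> nat \<Rightarrow> real \<Rightarrow> real" where
  "upper_tail b N x = (\<Sum>i | i \<le> N \<and> N + b < 2 * i. Bernstein N i x)"

lemma Bernstein_variance:
  "(\<Sum>i\<le>N. (real i - real N * x)\<^sup>2 * Bernstein N i x) = real N * x * (1 - x)"
proof -
  have "(\<Sum>i\<le>N. (real i - real N * x)\<^sup>2 * Bernstein N i x) =
     (\<Sum>i\<le>N. real i * (real i - 1) * Bernstein N i x + (1 - 2 * real N * x) * (real i * Bernstein N i x)
        + (real N * x)\<^sup>2 * Bernstein N i x)"
    by (intro sum.cong) (auto simp: algebra_simps power2_eq_square)
  also have "\<dots> = real N * (real N - 1) * x\<^sup>2 + (1 - 2 * real N * x) * (real N * x) + (real N * x)\<^sup>2"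
    unfolding sum.distrib sum_distrib_left[symmetric] by simp
  finally show ?thesis by (simp add: algebra_simps power2_eq_square)
qed

lemma Bernstein_Chebyshev:
  assumes x: "0 \<le> x" "x \<le> 1" and A: "A \<subseteq> {..N}" and d: "d > 0"
    and far: "\<And>i. i \<in> A \<Longrightarrow> d \<le> \<bar>real i - real N * x\<bar>"
  shows "(\<Sum>i\<in>A. Bernstein N i x) \<le> real N / d\<^sup>2"
proof -
  have "d\<^sup>2 * (\<Sum>i\<in>A. Bernstein N i x) \<le> (\<Sum>i\<in>A. (real i - real N * x)\<^sup>2 * Bernstein N i x)"
    unfolding sum_distrib_left
  proof (rule sum_mono)
    fix i assume "i \<in> A"
    have "d\<^sup>2 \<le> \<bar>real i - real N * x\<bar>\<^sup>2" using far[OF \<open>i \<in> A\<close>] d by (intro power_mono) auto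
    then show "d\<^sup>2 * Bernstein N i x \<le> (real i - real N * x)\<^sup>2 * Bernstein N i x"
      using Bernstein_nonneg[OF x] by (intro mult_right_mono) auto
  qed
  also have "\<dots> \<le> (\<Sum>i\<le>N. (real i - real N * x)\<^sup>2 * Bernstein N i x)"
    using A Bernstein_nonneg[OF x] by (intro sum_mono2) auto
  also have "\<dots> = real N * (x * (1 - x))" unfolding Bernstein_variance by simp
  also have "\<dots> \<le> real N * 1"
    using x mult_mono[of x 1 "1 - x" 1] by (intro mult_left_mono) auto
  finally show ?thesis using d by (simp add: field_simps)
qed

lemma upper_tail_nonneg: "0 \<le> x \<Longrightarrow> x \<le> 1 \<Longrightarrow> 0 \<le> upper_tail b N x"
  unfolding upper_tail_def using Bernstein_nonneg by (intro sum_nonneg) auto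

text \<open>Markov's inequality for the threshold \<open>N / 2\<close>. The bound vanishes linearly at 0 and so supplies the
integrable majorant when the exponent \<open>g - 2\<close> is at most \<open>-1\<close>.\<close>
lemma upper_tail_Markov:
  assumes x: "0 \<le> x" "x \<le> 1"
  shows "upper_tail b N x \<le> 2 * x"
proof (cases "N = 0")
  case True
  then have "{i. i \<le> N \<and> N + b < 2 * i} = {}" by auto
  then show ?thesis using x by (simp only: upper_tail_def sum.empty)
next
  case False
  let ?A = "{i. i \<le> N \<and> N + b < 2 * i}"
  have "real N * upper_tail b N x \<le> (\<Sum>i\<in>?A. 2 * (real i * Bernstein N i x))"
    unfolding upper_tail_def sum_distrib_left
  proof (rule sum_mono)
    fix i assume "i \<in> ?A"
    then have "real N \<le> 2 * real i" by auto
    then show "real N * Bernstein N i x \<le> 2 * (real i * Bernstein N i x)"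
      using mult_right_mono[OF _ Bernstein_nonneg[OF x, of N i], of "real N" "2 * real i"] by simp
  qed
  also have "\<dots> \<le> (\<Sum>i\<le>N. 2 * (real i * Bernstein N i x))"
    using Bernstein_nonneg[OF x] by (intro sum_mono2) auto
  also have "\<dots> = real N * (2 * x)" unfolding sum_distrib_left[symmetric] by simp
  finally show ?thesis using False by simp
qed

lemma upper_tail_below:
  assumes x: "0 \<le> x" "x < 1/2"
  shows "(\<lambda>N. upper_tail b N x) \<longlonglongrightarrow> 0"
proof (rule tendsto_sandwich[OF _ _ tendsto_const lim_const_over_n])
  let ?d = "1/2 - x"
  show "\<forall>\<^sub>F N in sequentially. 0 \<le> upper_tail b N x" using upper_tail_nonneg x by simp
  show "\<forall>\<^sub>F N in sequentially. upper_tail b N x \<le> (1 / ?d\<^sup>2) / real N"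
    using eventually_gt_at_top[of 0]
  proof eventually_elim
    case (elim N)
    have "upper_tail b N x \<le> real N / (real N * ?d)\<^sup>2"
      unfolding upper_tail_def
    proof (rule Bernstein_Chebyshev)
      fix i assume "i \<in> {i. i \<le> N \<and> N + b < 2 * i}"
      then have "real N \<le> 2 * real i" by auto
      moreover have "real N * ?d = real N / 2 - real N * x" by (simp add: algebra_simps)
      ultimately show "real N * ?d \<le> \<bar>real i - real N * x\<bar>" by linarith
    qed (use x elim in auto)
    also have "\<dots> = (1 / ?d\<^sup>2) / real N" using elim by (simp add: power2_eq_square)
    finally show ?case .
  qed
qed

lemma upper_tail_above:
  assumes x: "1/2 < x" "x \<le> 1"
  shows "(\<lambda>N. upper_tail b N x) \<longlonglongrightarrow> 1"
proof -
  let ?d = "x - 1/2"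
  have "(\<lambda>N. 1 - upper_tail b N x) \<longlonglongrightarrow> 0"
  proof (rule tendsto_sandwich[OF _ _ tendsto_const lim_const_over_n])
    have compl: "1 - upper_tail b N x = (\<Sum>i | i \<le> N \<and> 2 * i \<le> N + b. Bernstein N i x)" for N
    proof -
      have "{..N} = {i. i \<le> N \<and> N + b < 2 * i} \<union> {i. i \<le> N \<and> 2 * i \<le> N + b}" by auto
      then have "(\<Sum>i\<le>N. Bernstein N i x) =
          upper_tail b N x + (\<Sum>i | i \<le> N \<and> 2 * i \<le> N + b. Bernstein N i x)"
        unfolding upper_tail_def by (simp only:) (rule sum.union_disjoint, auto)
      then show ?thesis by simp
    qed
    show "\<forall>\<^sub>F N in sequentially. 0 \<le> 1 - upper_tail b N x"
      unfolding compl using Bernstein_nonneg[of x] x by (intro always_eventually allI sum_nonneg) simp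
    \<comment> \<open>Once \<open>N (x - 1/2) \<ge> b\<close>, the shift of the threshold by \<open>b / 2\<close> uses up at most half of the
      distance \<open>N (x - 1/2)\<close> from \<open>N / 2\<close> to the mean.\<close>
    show "\<forall>\<^sub>F N in sequentially. 1 - upper_tail b N x \<le> (4 / ?d\<^sup>2) / real N"
      using eventually_ge_at_top[of "nat \<lceil>real b / ?d\<rceil> + 1"]
    proof eventually_elim
      case (elim N)
      then have "N > 0" "real b / ?d \<le> real N" by linarith+
      then have b: "real b \<le> real N * ?d" using x by (simp add: field_simps)
      have "1 - upper_tail b N x \<le> real N / (real N * ?d / 2)\<^sup>2"
        unfolding compl
      proof (rule Bernstein_Chebyshev)
        fix i assume "i \<in> {i. i \<le> N \<and> 2 * i \<le> N + b}"
        then have "2 * real i \<le> real N + real b" by auto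
        moreover have "real N * ?d = real N * x - real N / 2" by (simp add: algebra_simps)
        ultimately show "real N * ?d / 2 \<le> \<bar>real i - real N * x\<bar>" using b by linarith
      qed (use x \<open>N > 0\<close> in auto)
      also have "\<dots> = (4 / ?d\<^sup>2) / real N" using \<open>N > 0\<close> by (simp add: power2_eq_square)
      finally show ?case .
    qed
  qed
  then show ?thesis using tendsto_diff[OF tendsto_const[of 1]] by fastforce
qed

text \<open>The unnormalised incomplete beta function at \<open>1/2\<close> with parameters \<open>m + 1\<close> and \<open>g - 1\<close>. The exponent
\<open>g - 2\<close> is chosen so that \<open>g = \<alpha>\<close> belongs to the children of a node and \<open>g = \<alpha> + 1\<close> to the node. The singularity at 1
lies outside the range of integration, so the value is finite and continuous for all real \<open>g\<close>.\<close>
definition half_integral :: "real \<Rightarrow> nat \<Rightarrow> real" where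
  "half_integral g m = integral {0..1/2} (\<lambda>t. t ^ m * (1 - t) powr (g - 2))"

text \<open>The variable of integration is the limiting proportion of the nodes outside the subtree, which makes
the limit an integral over \<open>[0, 1/2]\<close>; for this reason the tail is evaluated at \<open>1 - t\<close>.\<close>
lemma has_integral_upper_beta_sum:
  assumes g: "g > 0"
  shows "((\<lambda>t. t ^ m * (1 - t) powr (g - 2) * upper_tail b N (1 - t)) has_integral upper_beta_sum b m g N) {0<..<1}"
proof -
  let ?A = "{i. i \<le> N \<and> N + b < 2 * i}"
  have "finite ?A" by (rule finite_subset[of _ "{..N}"]) auto
  have "((\<lambda>t. \<Sum>i\<in>?A. real (N choose i) * (t powr (real (N - i + m + 1) - 1) * (1 - t) powr (g - 1 + real i - 1)))
      has_integral (\<Sum>i\<in>?A. real (N choose i) * Beta (real (N - i + m + 1)) (g - 1 + real i))) {0..1}"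
  proof (intro has_integral_sum has_integral_mult_right has_integral_Beta_real)
    show "g - 1 + real i > 0" if "i \<in> ?A" for i
    proof -
      have "i \<ge> 1" using that by auto
      then show ?thesis using g by linarith
    qed
  qed (use \<open>finite ?A\<close> in auto)
  then have "((\<lambda>t. \<Sum>i\<in>?A. real (N choose i) * (t powr (real (N - i + m + 1) - 1) * (1 - t) powr (g - 1 + real i - 1)))
      has_integral upper_beta_sum b m g N) {0<..<1}"
    unfolding has_integral_Icc_iff_Ioo upper_beta_sum_def by (simp only: Beta_commute[of "real _"])
  then show ?thesis
  proof (rule has_integral_eq[rotated])
    fix t :: real assume t: "t \<in> {0<..<1}"
    have "real (N choose i) * (t powr (real (N - i + m + 1) - 1) * (1 - t) powr (g - 1 + real i - 1)) =
        t ^ m * (1 - t) powr (g - 2) * Bernstein N i (1 - t)" for i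
    proof -
      have "t powr (real (N - i + m + 1) - 1) = t ^ (N - i) * t ^ m"
        using t powr_realpow[of t "N - i + m"] by (simp add: power_add)
      moreover have "(1 - t) powr (g - 1 + real i - 1) = (1 - t) powr (g - 2) * (1 - t) ^ i"
        using t by (simp add: powr_realpow[symmetric] powr_add[symmetric] algebra_simps)
      ultimately show ?thesis by (simp add: Bernstein_def)
    qed
    then show "(\<Sum>i\<in>?A. real (N choose i) * (t powr (real (N - i + m + 1) - 1) * (1 - t) powr (g - 1 + real i - 1)))
       = t ^ m * (1 - t) powr (g - 2) * upper_tail b N (1 - t)"
      by (simp only: upper_tail_def sum_distrib_left)
  qed
qed

text \<open>Dominated convergence with the majorant \<open>2 (1 - t) powr (g - 1)\<close>, which is integrable as \<open>g > 0\<close>. The law of large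
numbers decides the limit of the tail at every point except \<open>t = 1/2\<close>, which is removed together with
the two endpoints.\<close>
lemma upper_beta_sum_tendsto:
  assumes g: "g > 0"
  shows "upper_beta_sum b m g \<longlonglongrightarrow> half_integral g m"
proof -
  let ?S = "{0<..<1} - {1/2} :: real set"
  let ?k = "\<lambda>t :: real. t ^ m * (1 - t) powr (g - 2)"
  let ?f = "\<lambda>N t. ?k t * upper_tail b N (1 - t)"
  let ?g = "\<lambda>t. if t < 1/2 then ?k t else 0"
  have f: "(?f N has_integral upper_beta_sum b m g N) ?S" for N
  proof -
    have "negligible {x \<in> {0<..<1} - ?S. ?f N x \<noteq> 0}" "negligible {x \<in> ?S - {0<..<1}. ?f N x \<noteq> 0}"
      by (auto intro: negligible_subset[of "{1/2}"])
    then show ?thesis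
      using has_integral_upper_beta_sum[OF g] has_integral_spike_set_eq[of "{0<..<1}" ?S "?f N"] by blast
  qed
  have h: "(\<lambda>t. 2 * (1 - t) powr (g - 1)) integrable_on ?S"
  proof -
    have "((\<lambda>t. t powr (1 - 1) * (1 - t) powr (g - 1)) has_integral Beta 1 g) {0<..<1}"
      using has_integral_Beta_real[of 1 g] g by (simp add: has_integral_Icc_iff_Ioo)
    then have "((\<lambda>t. 2 * (t powr (1 - 1) * (1 - t) powr (g - 1))) has_integral 2 * Beta 1 g) {0<..<1}"
      by (rule has_integral_mult_right)
    then have "((\<lambda>t. 2 * (1 - t) powr (g - 1)) has_integral 2 * Beta 1 g) {0<..<1}"
      by (rule has_integral_eq[rotated]) auto
    moreover have "negligible {x \<in> {0<..<1} - ?S. 2 * (1 - x) powr (g - 1) \<noteq> 0}"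
        "negligible {x \<in> ?S - {0<..<1}. 2 * (1 - x) powr (g - 1) \<noteq> 0}"
      by (auto intro: negligible_subset[of "{1/2}"])
    ultimately show ?thesis
      using has_integral_spike_set_eq[of "{0<..<1}" ?S "\<lambda>t. 2 * (1 - t) powr (g - 1)"] by blast
  qed
  have le: "norm (?f N t) \<le> 2 * (1 - t) powr (g - 1)" if "t \<in> ?S" for N t
  proof -
    have t: "0 < t" "t < 1" using that by auto
    have "norm (?f N t) = t ^ m * ((1 - t) powr (g - 2) * upper_tail b N (1 - t))"
      using t upper_tail_nonneg[of "1 - t" b N] by (simp add: abs_mult)
    also have "\<dots> \<le> 1 * ((1 - t) powr (g - 2) * (2 * (1 - t)))"
      using t upper_tail_nonneg[of "1 - t" b N] upper_tail_Markov[of "1 - t" b N]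
      by (intro mult_mono mult_left_mono mult_nonneg_nonneg) (auto intro: power_le_one)
    also have "\<dots> = 2 * (1 - t) powr (g - 1)"
      using t powr_add[of "1 - t" "g - 2" 1] by simp
    finally show ?thesis .
  qed
  have conv: "(\<lambda>N. ?f N t) \<longlonglongrightarrow> ?g t" if "t \<in> ?S" for t
  proof (cases "t < 1/2")
    case True
    then have "(\<lambda>N. ?f N t) \<longlonglongrightarrow> ?k t * 1"
      using that by (intro tendsto_mult_left upper_tail_above) auto
    then show ?thesis using True by simp
  next
    case False
    then have "(\<lambda>N. ?f N t) \<longlonglongrightarrow> ?k t * 0"
      using that by (intro tendsto_mult_left upper_tail_below) auto
    then show ?thesis using False by simp
  qed
  have "(\<lambda>N. integral ?S (?f N)) \<longlonglongrightarrow> integral ?S ?g"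
    by (rule dominated_convergence(2)[OF has_integral_integrable[OF f] h le conv])
  moreover have "integral ?S (?f N) = upper_beta_sum b m g N" for N
    using f by (rule integral_unique)
  moreover have "integral ?S ?g = half_integral g m"
  proof -
    have "integral ?S ?g = integral UNIV (\<lambda>t. if t \<in> ?S then ?g t else 0)"
      by (rule integral_restrict_UNIV[symmetric])
    also have "\<dots> = integral UNIV (\<lambda>t. if t \<in> {0..1/2} then ?k t else 0)"
      by (rule integral_spike[of "{0, 1/2}"]) auto
    also have "\<dots> = half_integral g m" unfolding half_integral_def by (rule integral_restrict_UNIV)
    finally show ?thesis .
  qed
  ultimately show ?thesis by simp
qed

definition half_beta :: "real \<Rightarrow> nat \<Rightarrow> real" where
  "half_beta g m = pochhammer g m / fact m * half_integral g m"

lemma half_integral_integrable: "(\<lambda>t. t ^ m * (1 - t) powr (g - 2)) integrable_on {0..1/2 :: real}"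
  by (intro integrable_continuous_real continuous_intros) auto

lemma negative_binomial_series:
  assumes "\<bar>t\<bar> < (1 :: real)"
  shows "(\<lambda>m. pochhammer g m / fact m * t ^ m) sums (1 - t) powr (- g)"
proof -
  have "((- g) gchoose m) * (- t) ^ m = pochhammer g m / fact m * t ^ m" for m
  proof -
    have "((- g) gchoose m) * (- t) ^ m = pochhammer g m / fact m * ((- 1) ^ m * (- t) ^ m)"
      by (simp add: gbinomial_pochhammer)
    also have "(- 1) ^ m * (- t) ^ m = t ^ m" unfolding power_mult_distrib[symmetric] by simp
    finally show ?thesis .
  qed
  then show ?thesis using gen_binomial_real[of "- t" "- g"] assms by simp
qed

text \<open>Summing under the integral, the negative binomial series cancels the dependence on \<open>g\<close>: the integrand
becomes \<open>(1 - t)\<^sup>-\<^sup>2\<close>, whose integral over \<open>[0, 1/2]\<close> is 1. It is bounded by 4 there, so all partial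
sums have a common majorant.\<close>
lemma half_beta_sums:
  assumes g: "g > 0"
  shows "half_beta g sums 1"
proof -
  let ?c = "\<lambda>m. pochhammer g m / fact m"
  let ?f = "\<lambda>M t. \<Sum>m<M. ?c m * (t ^ m * (1 - t) powr (g - 2))"
  have c: "?c m \<ge> 0" for m using g by (simp add: pochhammer_nonneg)
  have lim: "(1 - t) powr (- g) * (1 - t) powr (g - 2) = 1 / (1 - t)\<^sup>2" if "t \<in> {0..1/2}" for t :: real
  proof -
    have "(1 - t) powr (- g) * (1 - t) powr (g - 2) = (1 - t) powr (- 2)"
      by (subst powr_add[symmetric]) simp
    also have "\<dots> = 1 / (1 - t) powr 2" by (rule powr_minus_divide)
    also have "(1 - t) powr 2 = (1 - t)\<^sup>2" using powr_realpow[of "1 - t" 2] that by simp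
    finally show ?thesis .
  qed
  have ser: "(\<lambda>m. ?c m * (t ^ m * (1 - t) powr (g - 2))) sums (1 / (1 - t)\<^sup>2)" if "t \<in> {0..1/2}" for t :: real
  proof -
    have "\<bar>t\<bar> < 1" using that by auto
    from sums_mult2[OF negative_binomial_series[OF this, of g], of "(1 - t) powr (g - 2)"]
    show ?thesis unfolding lim[OF that] by (simp only: mult.assoc)
  qed
  have f: "(?f M has_integral (\<Sum>m<M. half_beta g m)) {0..1/2}" for M
    unfolding half_beta_def half_integral_def
    by (intro has_integral_sum has_integral_mult_right integrable_integral half_integral_integrable) auto
  have "(\<lambda>M. integral {0..1/2} (?f M)) \<longlonglongrightarrow> integral {0..1/2} (\<lambda>t. 1 / (1 - t)\<^sup>2)"
  proof (rule dominated_convergence(2))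
    show "?f M integrable_on {0..1/2}" for M using f by blast
    show "(\<lambda>t. 4) integrable_on {0..1/2 :: real}" by (rule integrable_const_ivl)
    show "(\<lambda>M. ?f M t) \<longlonglongrightarrow> 1 / (1 - t)\<^sup>2" if "t \<in> {0..1/2}" for t
      using ser[OF that] by (simp add: sums_def)
    show "norm (?f M t) \<le> 4" if t: "t \<in> {0..1/2}" for M t
    proof -
      have nn: "?c m * (t ^ m * (1 - t) powr (g - 2)) \<ge> 0" for m
        using t by (intro mult_nonneg_nonneg c) auto
      have "?f M t \<le> 1 / (1 - t)\<^sup>2"
        using sum_le_suminf[OF sums_summable[OF ser[OF t]], of "{..<M}"] nn sums_unique[OF ser[OF t]] by simp
      also have "\<dots> \<le> 1 / (1/2)\<^sup>2" using t by (intro divide_left_mono power_mono) auto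
      finally show ?thesis using nn by (simp add: sum_nonneg power2_eq_square)
    qed
  qed
  moreover have "integral {0..1/2} (?f M) = (\<Sum>m<M. half_beta g m)" for M using f by (rule integral_unique)
  moreover have "((\<lambda>t. 1 / (1 - t)\<^sup>2) has_integral (1 / (1 - 1/2) - 1 / (1 - 0))) {0..1/2 :: real}"
    by (rule fundamental_theorem_of_calculus)
      (auto intro!: derivative_eq_intros simp: has_real_derivative_iff_has_vector_derivative[symmetric] power2_eq_square)
  then have "integral {0..1/2} (\<lambda>t. 1 / (1 - t)\<^sup>2) = (1 :: real)" by (simp add: integral_unique)
  ultimately show ?thesis by (simp add: sums_def)
qed

text \<open>For \<open>k = m + 1\<close>, the first part is the limiting probability that \<open>k\<close> is heavy, which is 1 at the root
\<open>k = 1\<close>, and \<open>a * half_beta a m\<close> is the limiting expected number of heavy children of \<open>k\<close>.\<close>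
definition limit_prob :: "real \<Rightarrow> nat \<Rightarrow> real" where
  "limit_prob a k = (case k of 0 \<Rightarrow> 0 | Suc m \<Rightarrow>
     (case m of 0 \<Rightarrow> 1 | Suc l \<Rightarrow> a * half_beta (a + 1) l) - a * half_beta a m)"

text \<open>Apart from the root, the heavy nodes are exactly the heavy children: both families have total mass \<open>a\<close>
and cancel, which leaves the mass 1 of the root.\<close>
lemma limit_prob_sums:
  assumes a: "a > 0"
  shows "limit_prob a sums 1"
proof -
  let ?u = "\<lambda>m. case m of 0 \<Rightarrow> 1 | Suc l \<Rightarrow> a * half_beta (a + 1) l"
  have "(\<lambda>l. ?u (Suc l)) sums (a * 1)" 
    using sums_mult[OF half_beta_sums[of "a + 1"], of a] a by simp
  then have "?u sums (a * 1 + ?u 0)" by (subst (asm) sums_Suc_iff) simp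
  moreover have "(\<lambda>m. a * half_beta a m) sums (a * 1)" by (intro sums_mult half_beta_sums a)
  ultimately have "(\<lambda>m. ?u m - a * half_beta a m) sums (a * 1 + ?u 0 - a * 1)" by (rule sums_diff)
  then have "(\<lambda>m. limit_prob a (Suc m)) sums 1" by (simp add: limit_prob_def)
  then show ?thesis by (subst (asm) sums_Suc_iff) (simp add: limit_prob_def)
qed

lemma centroid_prob_tendsto:
  assumes fam: "very_simple_family c1 c2" and a: "alpha c1 c2 > 0"
  shows "(\<lambda>n. measure_pmf.prob (random_tree c1 c2 n) {T. centroid_label T = k}) \<longlonglongrightarrow> limit_prob (alpha c1 c2) k"
proof -
  let ?P = "\<lambda>n. measure_pmf.prob (random_tree c1 c2 n) {T. centroid_label T = k}"
  let ?a = "alpha c1 c2"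
  consider "k = 0" | "k = 1" | m where "k = m + 2"
    by (metis One_nat_def add_2_eq_Suc' not0_implies_Suc)
  then show ?thesis
  proof cases
    case 1
    have "?P n = 0" if n: "n \<ge> 1" for n
    proof -
      have "increasing_trees n \<inter> {T. centroid_label T = k} = {}"
        using centroid_label_iff[OF n, of _ 0] 1 by force
      then show ?thesis unfolding random_tree_prob[OF fam n a] by simp
    qed
    then have "?P \<longlonglongrightarrow> 0" by (intro tendsto_eventually eventually_sequentiallyI[of 1]) 
    then show ?thesis using 1 by (simp add: limit_prob_def)
  next
    case 2
    have "(\<lambda>N. 1 - ?a * upper_beta_sum 1 0 ?a N) \<longlonglongrightarrow> 1 - ?a * half_integral ?a 0"
      by (intro tendsto_intros upper_beta_sum_tendsto a)
    then have "(\<lambda>N. ?P (N + 1)) \<longlonglongrightarrow> limit_prob ?a k"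
      using centroid_prob_finite(1)[OF fam a] 2 by (simp add: limit_prob_def half_beta_def)
    then show ?thesis by (rule LIMSEQ_offset)
  next
    case 3
    have "(\<lambda>N. ?a * pochhammer (?a + 1) m / fact m * upper_beta_sum m m (?a + 1) N
        - ?a * pochhammer ?a (m + 1) / fact (m + 1) * upper_beta_sum (m + 2) (m + 1) ?a N) \<longlonglongrightarrow>
        ?a * pochhammer (?a + 1) m / fact m * half_integral (?a + 1) m
        - ?a * pochhammer ?a (m + 1) / fact (m + 1) * half_integral ?a (m + 1)"
      using a by (intro tendsto_intros upper_beta_sum_tendsto) auto
    then have "(\<lambda>N. ?P (N + (m + 2))) \<longlonglongrightarrow>
        ?a * pochhammer (?a + 1) m / fact m * half_integral (?a + 1) m
        - ?a * pochhammer ?a (m + 1) / fact (m + 1) * half_integral ?a (m + 1)"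
      using centroid_prob_finite(2)[OF fam a, of m] unfolding 3 by (simp only: add.commute[of _ "m + 2"])
    also have "?a * pochhammer (?a + 1) m / fact m * half_integral (?a + 1) m
        - ?a * pochhammer ?a (m + 1) / fact (m + 1) * half_integral ?a (m + 1) = limit_prob ?a k"
      by (simp add: limit_prob_def half_beta_def 3)
    finally show ?thesis by (rule LIMSEQ_offset)
  qed
qed

section \<open>Closed forms in terms of the incomplete beta function\<close>

lemma half_integral_Suc: "half_integral g (Suc m) = half_integral g m - half_integral (g + 1) m"
proof -
  have "half_integral g (Suc m) = integral {0..1/2} (\<lambda>t. t ^ m * (1 - t) powr (g - 2) - t ^ m * (1 - t) powr (g + 1 - 2))"
    unfolding half_integral_def
  proof (rule integral_cong)
    fix t :: real assume t: "t \<in> {0..1/2}"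
    have "g + 1 - 2 = (g - 2) + 1" by simp
    then have "(1 - t) powr (g + 1 - 2) = (1 - t) powr (g - 2) * (1 - t) powr 1"
      by (simp only: powr_add)
    also have "(1 - t) powr 1 = 1 - t" using t by (intro powr_one) auto
    finally have eq: "(1 - t) powr (g + 1 - 2) = (1 - t) powr (g - 2) * (1 - t)" .
    have "t ^ Suc m * q = t ^ m * q - t ^ m * (q * (1 - t))" for q by (simp add: algebra_simps)
    then show "t ^ Suc m * (1 - t) powr (g - 2) = t ^ m * (1 - t) powr (g - 2) - t ^ m * (1 - t) powr (g + 1 - 2)"
      unfolding eq .
  qed
  also have "\<dots> = half_integral g m - half_integral (g + 1) m"
    unfolding half_integral_def by (intro integral_diff half_integral_integrable)
  finally show ?thesis .
qed

lemma DERIV_one_minus_powr: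
  assumes "t < (1 :: real)"
  shows "((\<lambda>t. (1 - t) powr r) has_real_derivative - (r * (1 - t) powr (r - 1))) (at t within S)"
proof -
  have "((\<lambda>t :: real. 1 - t) has_real_derivative 0 - 1) (at t)"
    by (intro DERIV_diff DERIV_const DERIV_ident)
  then have "((\<lambda>t. (1 - t) powr r) has_real_derivative r * (1 - t) powr (r - of_nat 1) * (0 - 1)) (at t)"
    by (rule DERIV_fun_powr) (use assms in linarith)
  then have "((\<lambda>t. (1 - t) powr r) has_real_derivative - (r * (1 - t) powr (r - 1))) (at t)"
    by (rule DERIV_cong) (simp only: of_nat_1, algebra)
  then show ?thesis by (rule has_field_derivative_at_within)
qed

text \<open>The fundamental theorem of calculus for \<open>t\<^bsup>m + 1\<^esup> (1 - t)\<^bsup>g - 1\<^esup>\<close>.\<close>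
lemma half_integral_by_parts:
  "real (m + 1) * half_integral (g + 1) m - (g - 1) * half_integral g (Suc m) = 2 powr (- (real m + g))"
proof -
  let ?F = "\<lambda>t :: real. t ^ Suc m * (1 - t) powr (g - 1)"
  let ?f = "\<lambda>t :: real. real (m + 1) * (t ^ m * (1 - t) powr (g + 1 - 2)) - (g - 1) * (t ^ Suc m * (1 - t) powr (g - 2))"
  have A: "(?f has_integral ?F (1/2) - ?F 0) {0..1/2}"
  proof (rule fundamental_theorem_of_calculus)
    fix t :: real assume t: "t \<in> {0..1/2}"
    then have p: "((\<lambda>t. (1 - t) powr (g - 1)) has_real_derivative - ((g - 1) * (1 - t) powr (g - 1 - 1)))
        (at t within {0..1/2})"
      by (intro DERIV_one_minus_powr) auto
    have "(?F has_real_derivative (real (Suc m) * t ^ (Suc m - Suc 0)) * (1 - t) powr (g - 1)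
        + (- ((g - 1) * (1 - t) powr (g - 1 - 1))) * t ^ Suc m) (at t within {0..1/2})"
      by (rule DERIV_mult[OF DERIV_pow p])
    moreover have "(real (Suc m) * t ^ (Suc m - Suc 0)) * (1 - t) powr (g - 1)
        + (- ((g - 1) * (1 - t) powr (g - 1 - 1))) * t ^ Suc m = ?f t"
    proof -
      have e: "g - 1 - 1 = g - 2" "g + 1 - 2 = g - 1" "Suc m - Suc 0 = m" by simp_all
      have "(real (Suc m) * t ^ m) * P + (- ((g - 1) * Q)) * t ^ Suc m =
          real (m + 1) * (t ^ m * P) - (g - 1) * (t ^ Suc m * Q)" for P Q
        by (simp add: algebra_simps)
      then show ?thesis unfolding e .
    qed
    ultimately show "(?F has_vector_derivative ?f t) (at t within {0..1/2})"
      by (simp only: has_real_derivative_iff_has_vector_derivative)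
  qed simp
  have B: "(?f has_integral real (m + 1) * half_integral (g + 1) m - (g - 1) * half_integral g (Suc m)) {0..1/2}"
    unfolding half_integral_def
    by (intro has_integral_diff has_integral_mult_right integrable_integral half_integral_integrable)
  have "real (m + 1) * half_integral (g + 1) m - (g - 1) * half_integral g (Suc m) = ?F (1/2) - ?F 0"
    using B A by (rule has_integral_unique)
  also have "\<dots> = (1/2) ^ Suc m * (1/2) powr (g - 1)" by simp
  also have "(1/2 :: real) ^ Suc m = (1/2) powr (real (Suc m))" by (rule powr_realpow[symmetric]) simp
  also have "(1/2 :: real) powr (real (Suc m)) * (1/2) powr (g - 1) = (1/2) powr (real (Suc m) + (g - 1))"
    by (rule powr_add[symmetric])
  also have "real (Suc m) + (g - 1) = real m + g" by simp
  also have "(1/2 :: real) powr (real m + g) = 2 powr (- (real m + g))"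
    by (simp only: powr_minus_divide powr_divide powr_one_eq_one)
  finally show ?thesis .
qed

lemma half_integral_0:
  "(g - 1) * half_integral g 0 = 1 - 2 powr (- (g - 1))"
proof -
  let ?F = "\<lambda>t :: real. - ((1 - t) powr (g - 1))"
  have A: "((\<lambda>t. (g - 1) * (t ^ 0 * (1 - t) powr (g - 2))) has_integral ?F (1/2) - ?F 0) {0..1/2}"
  proof (rule fundamental_theorem_of_calculus)
    fix t :: real assume t: "t \<in> {0..1/2}"
    have "t < 1" using t by auto
    from DERIV_minus[OF DERIV_one_minus_powr[OF this, of "g - 1" "{0..1/2}"]]
    have "(?F has_real_derivative (g - 1) * (t ^ 0 * (1 - t) powr (g - 2))) (at t within {0..1/2})"
      by (rule DERIV_cong) (simp only: minus_minus power_0 mult_1_left diff_diff_eq one_add_one)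
    then show "(?F has_vector_derivative (g - 1) * (t ^ 0 * (1 - t) powr (g - 2))) (at t within {0..1/2})"
      by (simp only: has_real_derivative_iff_has_vector_derivative)
  qed simp
  have B: "((\<lambda>t. (g - 1) * (t ^ 0 * (1 - t) powr (g - 2))) has_integral (g - 1) * half_integral g 0) {0..1/2}"
    unfolding half_integral_def by (intro has_integral_mult_right integrable_integral half_integral_integrable)
  have "(g - 1) * half_integral g 0 = ?F (1/2) - ?F 0" using B A by (rule has_integral_unique)
  also have "\<dots> = 1 - (1/2) powr (g - 1)"
    by (simp only: diff_0_right powr_one_eq_one minus_diff_minus) simp
  also have "(1/2 :: real) powr (g - 1) = 2 powr (- (g - 1))"
    by (simp only: powr_minus_divide powr_divide powr_one_eq_one)
  finally show ?thesis .
qed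

text \<open>The normalising constant is a quotient of Gamma functions at points that differ by the integer \<open>m + 1\<close>,
hence a rising factorial. The formula covers negative non-integer \<open>b\<close>, which occurs as \<open>b = \<alpha> - 1\<close>.\<close>
lemma reg_inc_beta_half:
  assumes b: "b \<notin> \<int>\<^sub>\<le>\<^sub>0"
  shows "reg_inc_beta (1/2) (real (m + 1)) b = b * half_beta (b + 1) m"
proof -
  have G: "Gamma (b + real (m + 1)) = pochhammer b (m + 1) * Gamma b"
    using pochhammer_Gamma[OF b, of "m + 1"] Gamma_nonzero[OF b] by simp
  have "Gamma (real (m + 1)) = fact m" using Gamma_fact[of m, where 'a=real] by (simp add: add.commute)
  then have "1 / Beta (real (m + 1)) b = pochhammer b (m + 1) / fact m"
    using Gamma_nonzero[OF b] G by (simp add: Beta_def add.commute)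
  moreover have "integral {0..1/2} (\<lambda>t. t powr (real (m + 1) - 1) * (1 - t) powr (b - 1)) = half_integral (b + 1) m"
    unfolding half_integral_def
  proof (rule integral_spike[of "{0}"])
    fix t :: real assume "t \<in> {0..1/2} - {0}"
    then show "t ^ m * (1 - t) powr (b + 1 - 2) = t powr (real (m + 1) - 1) * (1 - t) powr (b - 1)"
      using powr_realpow[of t m] by simp
  qed simp
  moreover have "pochhammer b (m + 1) = b * pochhammer (b + 1) m" using pochhammer_rec[of b m] by simp
  ultimately show ?thesis by (simp add: reg_inc_beta_def half_beta_def)
qed

lemma centroid_prob_eq_limit_prob:
  assumes a: "a > 0" "a \<noteq> 1" and k: "k \<ge> 1"
  shows "centroid_prob a k = limit_prob a k"
proof -
  consider "k = 1" | m where "k = m + 2" using k by (metis One_nat_def add_2_eq_Suc' le_SucE le_Suc_eq not0_implies_Suc not_one_le_zero)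
  then show ?thesis
  proof cases
    case 1
    have "a / (a - 1) * (1 - 2 powr (- (a - 1))) = a * half_integral a 0"
      unfolding half_integral_0[symmetric] using a by simp
    then show ?thesis using 1 by (simp add: centroid_prob_def limit_prob_def half_beta_def)
  next
    case 2
    have "a \<notin> \<int>\<^sub>\<le>\<^sub>0" using a by (auto elim!: nonpos_Ints_cases)
    moreover have "a - 1 \<notin> \<int>\<^sub>\<le>\<^sub>0"
    proof
      assume "a - 1 \<in> \<int>\<^sub>\<le>\<^sub>0"
      then obtain n :: int where n: "a - 1 = of_int n" "n \<le> 0" by (auto elim: nonpos_Ints_cases)
      then have "real_of_int n > real_of_int (- 1)" using a by simp
      then have "n = 0" using n(2) by linarith
      then show False using n(1) a by simp
    qed
    ultimately have "reg_inc_beta (1/2) (real (m + 1)) a = a * half_beta (a + 1) m"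
      "reg_inc_beta (1/2) (real (Suc m + 1)) (a - 1) = (a - 1) * half_beta a (Suc m)"
      using reg_inc_beta_half[of a m] reg_inc_beta_half[of "a - 1" "Suc m"] by simp_all
    moreover have "real k - 1 = real (m + 1)" "real k = real (Suc m + 1)" using 2 by simp_all
    ultimately have "centroid_prob a k = a * half_beta (a + 1) m - a / (a - 1) * ((a - 1) * half_beta a (Suc m))"
      using 2 by (simp only: centroid_prob_def) simp
    then show ?thesis using a 2 by (simp add: limit_prob_def)
  qed
qed

text \<open>By the relations between neighbouring integrals, both expressions reduce, up to the common factor
\<open>pochhammer a (m + 1) / fact (m + 1)\<close>, to \<open>2 D - half_integral a (m + 1)\<close>, where \<open>D\<close> is the power of 2
in the alternative formula. The case \<open>k = 1\<close> is elementary and is treated separately.\<close>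
lemma centroid_prob_alt_eq_limit_prob:
  assumes a: "a > 0" "a \<noteq> 1" and k: "k \<ge> 1"
  shows "centroid_prob_alt a k = limit_prob a k"
proof -
  have aZ: "a \<notin> \<int>\<^sub>\<le>\<^sub>0" using a by (auto elim!: nonpos_Ints_cases)
  have a1: "a - 1 \<noteq> 0" using a by simp
  consider "k = 1" | m where "k = m + 2" using k by (metis One_nat_def add_2_eq_Suc' le_SucE le_Suc_eq not0_implies_Suc not_one_le_zero)
  then show ?thesis
  proof cases
    case 1
    have h1: "a * half_integral (a + 1) 0 = 1 - 2 powr (- a)" using half_integral_0[of "a + 1"] by simp
    have "2 powr (- (a - 1)) = 2 * 2 powr (- a)" using powr_add[of 2 1 "- a"] by simp
    then have h0: "(a - 1) * half_integral a 0 = 1 - 2 * 2 powr (- a)" using half_integral_0[of a] by simp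
    have "reg_inc_beta (1/2) (real k) a = a * half_integral (a + 1) 0"
      using reg_inc_beta_half[OF aZ, of 0] 1 by (simp add: half_beta_def)
    then have R: "reg_inc_beta (1/2) (real k) a = 1 - 2 powr (- a)" using h1 by simp
    have "centroid_prob_alt a k = - (1 / (a - 1)) * (1 - 2 powr (- a)) + (1 + a / (a - 1)) * 2 powr (- a)"
      unfolding centroid_prob_alt_def R using 1 by simp
    moreover have "(a - 1) * (- (1 / (a - 1)) * (1 - D) + (1 + a / (a - 1)) * D) = (a - 1) - a * (1 - 2 * D)" for D
    proof -
      have "(a - 1) * (- (1 / (a - 1)) * (1 - D)) = D - 1" "(a - 1) * ((1 + a / (a - 1)) * D) = (2 * a - 1) * D"
        using a1 by (simp_all add: field_simps)
      then show ?thesis unfolding distrib_left by (simp add: algebra_simps)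
    qed
    moreover have "limit_prob a k = 1 - a * half_integral a 0"
      using 1 by (simp add: limit_prob_def half_beta_def)
    moreover have "(a - 1) * (1 - a * h) = (a - 1) - a * ((a - 1) * h)" for h
      by (simp add: algebra_simps)
    ultimately have "(a - 1) * centroid_prob_alt a k = (a - 1) * limit_prob a k"
      by (simp only: h0)
    then show ?thesis using a1 by simp
  next
    case 2
    let ?c = "pochhammer a (m + 1) / fact (m + 1)"
    let ?D = "2 powr (- (a + real m + 1))"
    have D: "2 powr (- (real m + a)) = 2 * ?D" using powr_add[of 2 1 "- (a + real m + 1)"] by (simp add: add.commute)
    have E1: "real (m + 1) * half_integral (a + 1) m = 2 * ?D + (a - 1) * half_integral a (Suc m)"
      using half_integral_by_parts[of m a] D by simp
    have E2: "(a + real m + 1) * half_integral (a + 1) (Suc m) = ?D + (a - 1) * half_integral a (Suc m)"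
      using half_integral_by_parts[of "Suc m" a] half_integral_Suc[of a "Suc m"] by (simp add: algebra_simps)
    have "a * half_beta (a + 1) m = ?c * (real (m + 1) * half_integral (a + 1) m)"
    proof -
      have "fact (m + 1) = real (m + 1) * fact m" by simp
      moreover have "P / (r * f) * (r * h) = P / f * h" if "r \<noteq> 0" for P r f h :: real
        using that by simp
      moreover have "real (m + 1) \<noteq> 0" by simp
      moreover have "pochhammer a (m + 1) = a * pochhammer (a + 1) m" using pochhammer_rec[of a m] by simp
      ultimately show ?thesis by (simp only: half_beta_def) simp
    qed
    then have "limit_prob a k = ?c * (real (m + 1) * half_integral (a + 1) m - a * half_integral a (Suc m))"
      using 2 by (simp add: limit_prob_def half_beta_def algebra_simps)
    then have L: "limit_prob a k = ?c * (2 * ?D - half_integral a (Suc m))"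
      unfolding E1 by (simp add: algebra_simps)
    have "a * pochhammer (a + 1) (Suc m) = pochhammer a (Suc m) * (a + real m + 1)"
      using pochhammer_rec[of a "Suc m"] pochhammer_Suc[of a "Suc m"] by (simp add: algebra_simps)
    then have "a * half_beta (a + 1) (Suc m) = ?c * ((a + real m + 1) * half_integral (a + 1) (Suc m))"
      by (simp add: half_beta_def mult.assoc[symmetric])
    then have R: "reg_inc_beta (1/2) (real k) a = ?c * (?D + (a - 1) * half_integral a (Suc m))"
      using reg_inc_beta_half[OF aZ, of "Suc m"] 2 unfolding E2 by simp
    have B: "(a + real k - 2) gchoose (k - 1) = ?c"
      using 2 by (simp add: gbinomial_pochhammer')
    have P: "2 powr (- (a + real k - 1)) = ?D" using 2 by (simp add: algebra_simps)
    have "centroid_prob_alt a k = - (1 / (a - 1)) * (?c * (?D + (a - 1) * half_integral a (Suc m)))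
       + (1 + a / (a - 1)) * ?c * ?D"
      unfolding centroid_prob_alt_def R B P ..
    also have "\<dots> = ?c * (2 * ?D - half_integral a (Suc m))"
    proof -
      define e where "e = 1 / (a - 1)"
      have e: "e * (a - 1) = 1" "a / (a - 1) = 1 + e" using a1 by (simp_all add: e_def field_simps)
      have "- e * (c * (D + (a - 1) * h)) + (1 + (1 + e)) * c * D = c * (2 * D - h)" for c D h
      proof -
        have "- e * (c * (D + (a - 1) * h)) + (1 + (1 + e)) * c * D = c * (2 * D) - (e * (a - 1)) * (c * h)"
          by (simp add: algebra_simps)
        then show ?thesis unfolding e(1) by (simp add: algebra_simps)
      qed
      then show ?thesis unfolding e(2) e_def[symmetric] .
    qed
    finally show ?thesis using L by simp
  qed
qed

lemma isCont_half_beta: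
  assumes "g > 0"
  shows "isCont (\<lambda>g. half_beta g m) g"
proof -
  have "continuous_on UNIV (\<lambda>g. integral (cbox 0 (1/2)) (\<lambda>t :: real. t ^ m * (1 - t) powr (g - 2)))"
    by (rule integral_continuous_on_param)
      (auto intro!: continuous_intros simp: case_prod_unfold)
  then have "isCont (\<lambda>g. half_integral g m) g"
    by (simp add: half_integral_def continuous_on_eq_continuous_at)
  moreover have "isCont (\<lambda>g :: real. pochhammer g m / fact m) g"
    unfolding pochhammer_prod by (intro continuous_intros) auto
  ultimately show ?thesis unfolding half_beta_def by (intro continuous_mult)
qed

lemma isCont_limit_prob:
  assumes "a > 0"
  shows "isCont (\<lambda>a. limit_prob a k) a"
proof -
  have shift: "isCont (\<lambda>a. half_beta (a + 1) l) a" for l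
    using isCont_o2[of a "\<lambda>a. a + 1" "\<lambda>g. half_beta g l"] isCont_half_beta[of "a + 1" l] assms by simp
  show ?thesis unfolding limit_prob_def
    using isCont_half_beta[OF assms] shift
    by (cases k; cases "k - 1") (auto intro!: continuous_intros)
qed

text \<open>The closed forms agree with \<open>limit_prob\<close> near \<open>a = 1\<close> but not at 1, where they divide by zero; the limit
is therefore taken of \<open>limit_prob\<close>, which is continuous at 1.\<close>
lemma tendsto_limit_prob_1:
  assumes "\<And>a. a > 0 \<Longrightarrow> a \<noteq> 1 \<Longrightarrow> f a = limit_prob a k"
  shows "(f \<longlongrightarrow> limit_prob 1 k) (at 1)"
proof (rule Lim_transform_eventually)
  show "((\<lambda>a. limit_prob a k) \<longlongrightarrow> limit_prob 1 k) (at 1)"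
    using isCont_limit_prob[of 1 k] by (simp add: isCont_def)
  have "eventually (\<lambda>a :: real. a > 0) (at 1)"
    by (rule order_tendstoD(1)[OF tendsto_ident_at zero_less_one])
  moreover have "eventually (\<lambda>a :: real. a \<noteq> 1) (at 1)" by (rule eventually_neq_at_within)
  ultimately show "eventually (\<lambda>a. limit_prob a k = f a) (at 1)"
    by eventually_elim (use assms in auto)
qed

text \<open>A distribution function on the natural numbers is a finite sum of point probabilities, so pointwise
convergence to a probability mass function suffices.\<close>
lemma weak_conv_m_nat_pmf:
  fixes q :: "nat \<Rightarrow> nat pmf"
  assumes "\<And>k. (\<lambda>n. pmf (q n) k) \<longlonglongrightarrow> pmf p k"
  shows "weak_conv_m (\<lambda>n. distr (measure_pmf (q n)) borel real) (distr (measure_pmf p) borel real)"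
proof -
  have cdf: "cdf (distr (measure_pmf r) borel real) x = (\<Sum>k | real k \<le> x. pmf r k)" for r :: "nat pmf" and x
  proof -
    have fin: "finite {k. real k \<le> x}"
      by (rule finite_subset[of _ "{..nat \<lfloor>x\<rfloor>}"]) (auto simp: le_nat_floor)
    have "cdf (distr (measure_pmf r) borel real) x = measure (measure_pmf r) (real -` {..x} \<inter> space (measure_pmf r))"
      unfolding cdf_def by (rule measure_distr) auto
    also have "real -` {..x} \<inter> space (measure_pmf r) = {k. real k \<le> x}" by auto
    finally show ?thesis using measure_measure_pmf_finite[OF fin] by simp
  qed
  show ?thesis unfolding weak_conv_m_def weak_conv_def cdf using assms by (auto intro!: tendsto_sum)
qed

lemma alpha_pos:
  assumes "very_simple_family c1 c2"
  shows "alpha c1 c2 > 0"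
proof -
  have "alpha c1 c2 > 0" if "c2 \<ge> 0" using assms that
    by (auto simp: very_simple_family_def alpha_def intro: add_pos_nonneg)
  then show ?thesis using assms by (force simp: very_simple_family_def)
qed

theorem theorem11:
  fixes c1 c2 \<alpha> :: real
  assumes "very_simple_family c1 c2"
    and "\<alpha> = alpha c1 c2"
  shows "\<exists>p :: nat pmf.
    set_pmf p \<subseteq> {1..} \<and>
    weak_conv_m
      (\<lambda>n. distr (measure_pmf (random_tree c1 c2 n)) borel (\<lambda>T. real (centroid_label T)))
      (distr (measure_pmf p) borel real) \<and>
    (\<forall>k\<ge>1.
      (\<lambda>n. measure_pmf.prob (random_tree c1 c2 n) {T. centroid_label T = k})
        \<longlonglongrightarrow> pmf p k) \<and>
    (\<forall>k\<ge>1.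
      (\<alpha> \<noteq> 1 \<longrightarrow> pmf p k = centroid_prob \<alpha> k \<and> pmf p k = centroid_prob_alt \<alpha> k) \<and>
      (\<alpha> = 1 \<longrightarrow> ((\<lambda>a. centroid_prob a k) \<longlongrightarrow> pmf p k) (at 1) \<and>
                 ((\<lambda>a. centroid_prob_alt a k) \<longlongrightarrow> pmf p k) (at 1)))"
proof -
  have a: "\<alpha> > 0" using alpha_pos[OF assms(1)] assms(2) by simp
  note lim = centroid_prob_tendsto[OF assms(1) alpha_pos[OF assms(1)], folded assms(2)]
  have nonneg: "limit_prob \<alpha> k \<ge> 0" for k
    by (rule LIMSEQ_le_const[OF lim]) auto
  have one: "(\<integral>\<^sup>+ k. ennreal (limit_prob \<alpha> k) \<partial>count_space UNIV) = 1"
    using nonneg sums_unique[OF limit_prob_sums[OF a]] sums_summable[OF limit_prob_sums[OF a]]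
    by (simp add: nn_integral_count_space_nat suminf_ennreal2)
  define p where "p = embed_pmf (limit_prob \<alpha>)"
  have p: "pmf p k = limit_prob \<alpha> k" for k
    unfolding p_def by (rule pmf_embed_pmf[OF nonneg one])
  have "pmf p 0 = 0" unfolding p by (simp add: limit_prob_def)
  then have supp: "set_pmf p \<subseteq> {1..}"
    by (metis One_nat_def Suc_leI atLeast_iff gr0I set_pmf_iff subsetI)
  have weak: "weak_conv_m
      (\<lambda>n. distr (measure_pmf (random_tree c1 c2 n)) borel (\<lambda>T. real (centroid_label T)))
      (distr (measure_pmf p) borel real)"
  proof -
    have "weak_conv_m (\<lambda>n. distr (measure_pmf (map_pmf centroid_label (random_tree c1 c2 n))) borel real)
      (distr (measure_pmf p) borel real)"
    proof (rule weak_conv_m_nat_pmf)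
      fix k
      show "(\<lambda>n. pmf (map_pmf centroid_label (random_tree c1 c2 n)) k) \<longlonglongrightarrow> pmf p k"
        unfolding p pmf_map vimage_def using lim[of k] by simp
    qed
    moreover have "distr (measure_pmf (map_pmf centroid_label (random_tree c1 c2 n))) borel real =
        distr (measure_pmf (random_tree c1 c2 n)) borel (\<lambda>T. real (centroid_label T))" for n
      unfolding map_pmf_rep_eq by (subst distr_distr) (auto simp: o_def)
    ultimately show ?thesis by simp
  qed
  have ne: "\<alpha> \<noteq> 1 \<longrightarrow> pmf p k = centroid_prob \<alpha> k \<and> pmf p k = centroid_prob_alt \<alpha> k"
    if "k \<ge> 1" for k
    unfolding p using centroid_prob_eq_limit_prob centroid_prob_alt_eq_limit_prob a that by simp
  have eq: "\<alpha> = 1 \<longrightarrow> ((\<lambda>a. centroid_prob a k) \<longlongrightarrow> pmf p k) (at 1) \<and>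
                 ((\<lambda>a. centroid_prob_alt a k) \<longlongrightarrow> pmf p k) (at 1)"
    if "k \<ge> 1" for k
    unfolding p using tendsto_limit_prob_1[of "\<lambda>a. centroid_prob a k" k]
      tendsto_limit_prob_1[of "\<lambda>a. centroid_prob_alt a k" k]
      centroid_prob_eq_limit_prob centroid_prob_alt_eq_limit_prob that by auto
  show ?thesis
  proof (intro exI[of _ p] conjI allI impI)
    fix k :: nat assume k: "k \<ge> 1"
    show "(\<lambda>n. measure_pmf.prob (random_tree c1 c2 n) {T. centroid_label T = k}) \<longlonglongrightarrow> pmf p k"
      unfolding p by (rule lim)
    show "pmf p k = centroid_prob \<alpha> k" "pmf p k = centroid_prob_alt \<alpha> k" if "\<alpha> \<noteq> 1"
      using ne[OF k] that by blast+
    show "((\<lambda>a. centroid_prob a k) \<longlongrightarrow> pmf p k) (at 1)"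
      "((\<lambda>a. centroid_prob_alt a k) \<longlongrightarrow> pmf p k) (at 1)" if "\<alpha> = 1"
      using eq[OF k] that by blast+
  qed (fact supp weak)+
qed

end
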